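(* Assume that both the controller and the adversary are weakly communicating, that $\{\delta_a:a\in A\}\subseteq Q$, and that $Q$ and $\mathcal{P}_s$, $s\in S$, are compact. Let $(u^*,\alpha^* )$ and $(u',\alpha')$, with $u^*,u':S\to\mathbb{R}$ and $\alpha^*,\alpha'\in[0,1]$, be solutions (which exist) of $$u^*(s)=\sup_{\phi\in Q}\inf_{p_s\in\mathcal{P}_s}\sum_{a\in A}\sum_{s'\in S}\phi(a)p_s(s'|a)\big[r(s,a)-\alpha^*+u^*(s')\big]\quad\forall s\in S$$ and $$u'(s)=\inf_{p_s\in\mathcal{P}_s}\sup_{\phi\in Q}\sum_{a\in A}\sum_{s'\in S}\phi(a)p_s(s'|a)\big[r(s,a)-\alpha'+u'(s')\big]\quad\forall s\in S,$$ respectively. If the adversary's policy class is the stationary class $K_S$, then stationary policies are optimal for a history-dependent controller, i.e. for every $\mu\in\mathrm{Prob}(S)$ $$\overline\alpha(\mu,\Pi_S,K_S)=\overline\alpha(\mu,\Pi_H,K_S)\quad\text{and}\quad\underline\alpha(\mu,\Pi_S,K_S)=\underline\alpha(\mu,\Pi_H,K_S),$$ if and only if $\alpha'=\alpha^*$.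
   Context: $S$ (states) and $A$ (actions) are finite nonempty sets; $\mathrm{Prob}(E)$ is the set of probability distributions on a finite set $E$; $\delta_a$ is the Dirac measure at $a$; $r:S\times A\to[0,1]$ is a reward function. $Q\subseteq\mathrm{Prob}(A)$ is the set of the controller's admissible randomized actions. For each $s\in S$, $\mathcal{P}_s$ is a nonempty set of maps $p_s:A\to\mathrm{Prob}(S)$, written $p_s(s'|a)$; $\mathcal{P}=\prod_{s\in S}\mathcal{P}_s$, and $p\in\mathcal{P}$ is written $p(s'|s,a)=p_s(s'|a)$. Compactness is in the Euclidean topology. Histories: $h_t=(s_0,a_0,\dots,s_{t-1},a_{t-1},s_t)\in(S\times A)^t\times S$. $\Pi_H$ is the set of history-dependent controller policies $\pi=(\pi_0,\pi_1,\dots)$ with $\pi_t(\cdot|h_t)\in Q$ for all $t,h_t$. $\Pi_S\subseteq\Pi_H$ is the set of stationary ones, $\pi_t(\cdot|h_t)=\Delta(\cdot|s_t)$ for a single map $\Delta:S\to Q$. $K_S$ is the set of stationary adversary policies $\kappa=(\kappa_0,\kappa_1,\dots)$, i.e. $\kappa_t(s'|h_t,a)=p(s'|s_t,a)$ for a single $p\in\mathcal{P}$ (identified with $p$). For $\mu\in\mathrm{Prob}(S)$, $\pi$, $\kappa$, $E_\mu^{\pi,\kappa}$ is expectation under the law of $(X_0,A_0,X_1,A_1,\dots)$ with $X_0\sim\mu$, $A_t\sim\pi_t(\cdot|H_t)$ given $H_t=(X_0,A_0,\dots,X_t)$, and $X_{t+1}\sim\kappa_t(\cdot|H_t,A_t)$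 given $(H_t,A_t)$. Define $$\overline\alpha(\mu,\pi,\kappa)=\limsup_{n\to\infty}E_\mu^{\pi,\kappa}\frac1n\sum_{k=0}^{n-1}r(X_k,A_k),\quad \underline\alpha(\mu,\pi,\kappa)=\liminf_{n\to\infty}E_\mu^{\pi,\kappa}\frac1n\sum_{k=0}^{n-1}r(X_k,A_k),$$ $\overline\alpha(\mu,\Pi,K)=\sup_{\pi\in\Pi}\inf_{\kappa\in K}\overline\alpha(\mu,\pi,\kappa)$, $\underline\alpha(\mu,\Pi,K)=\sup_{\pi\in\Pi}\inf_{\kappa\in K}\underline\alpha(\mu,\pi,\kappa)$. For $p\in\mathcal{P}$ and $\Delta:S\to Q$, $p_\Delta(s'|s)=\sum_{a}p(s'|s,a)\Delta(a|s)$ and $p_\Delta^n$ is its $n$-th matrix power. $\Delta:S\to Q$ is weakly communicating if there is a set $C_\Delta\subseteq S$ such that for any $s,s'\in C_\Delta$ there exist $p\in\mathcal{P}$ and $N\ge1$ with $p_\Delta^N(s'|s)>0$, and every $s\in S\setminus C_\Delta$ is transient for the chain $p_\Delta$ for every $p\in\mathcal{P}$. $p\in\mathcal{P}$ is weakly communicating if there is a set $C_p\subseteq S$ such that for any $s,s'\in C_p$ there exist $\Delta:S\to Q$ and $N\ge1$ with $p_\Delta^N(s'|s)>0$, and every $s\in S\setminus C_p$ is transient for the chain $p_\Delta$ for every $\Delta:S\to Q$. The controller (resp. adversary) is weakly communicating if every $\Delta:S\to Q$ (resp. every $p\in\mathcal{P}$) is. *)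

theory Defs
  imports "HOL-Probability.Probability"
begin

section \<open>Laws of discrete-time processes\<close>

text \<open>
  \<open>path_law K\<close> is the law, on infinite sequences, of the process whose next coordinate has
  distribution \<open>K xs\<close> given that the previous coordinates are \<open>xs\<close>; it is the projective limit
  given by the Ionescu-Tulcea theorem.
\<close>

definition path_kernel :: "('b list \<Rightarrow> 'b pmf) \<Rightarrow> nat \<Rightarrow> (nat \<Rightarrow> 'b) \<Rightarrow> 'b measure" where
  "path_kernel K i \<omega> = measure_pmf (K (map \<omega> [0..<i]))"

definition path_law :: "('b list \<Rightarrow> 'b pmf) \<Rightarrow> (nat \<Rightarrow> 'b) measure" where
  "path_law K = projective_family.lim UNIV
     (Ionescu_Tulcea.CI (path_kernel K) (\<lambda>_. count_space UNIV)) (\<lambda>_. count_space UNIV)"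

lemma Ionescu_Tulcea_path_kernel:
  fixes K :: "'b::finite list \<Rightarrow> 'b pmf"
  shows "Ionescu_Tulcea (path_kernel K) (\<lambda>_. count_space UNIV)"
proof (rule Ionescu_Tulcea.intro)
  fix i :: nat
  have eq: "PiM {0..<i} (\<lambda>_. count_space (UNIV :: 'b set)) = count_space (PiE {0..<i} (\<lambda>_. UNIV))"
    by (rule count_space_PiM_finite) auto
  show "path_kernel K i \<in> measurable (PiM {0..<i} (\<lambda>_. count_space UNIV))
          (subprob_algebra (count_space UNIV))"
    unfolding eq path_kernel_def
    by (auto simp: space_subprob_algebra measure_pmf.subprob_space_axioms)
next
  fix i :: nat and \<omega> :: "nat \<Rightarrow> 'b"
  show "prob_space (path_kernel K i \<omega>)"
    by (simp add: path_kernel_def measure_pmf.prob_space_axioms)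
qed

text \<open>The cylinder probabilities, which determine \<open>path_law K\<close>.\<close>

lemma measure_path_law_cylinder:
  fixes K :: "'b::finite list \<Rightarrow> 'b pmf"
  shows "measure (path_law K) {\<omega>. \<forall>i<length xs. \<omega> i = xs ! i} =
           (\<Prod>i<length xs. pmf (K (take i xs)) (xs ! i))"
proof -
  interpret IT: Ionescu_Tulcea "path_kernel K" "\<lambda>_. count_space UNIV"
    by (rule Ionescu_Tulcea_path_kernel)
  let ?M = "\<lambda>_. count_space (UNIV :: 'b set)"
  define y where "y n = restrict ((!) xs) {0..<n}" for n
  have PiM_eq: "PiM {0..<n} ?M = count_space (PiE {0..<n} (\<lambda>_. UNIV))" for n :: nat
    by (rule count_space_PiM_finite) auto
  have sing: "{y n} \<in> sets (PiM {0..<n} ?M)" for n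
    by (simp add: PiM_eq y_def)
  have C: "emeasure (IT.C 0 n (\<lambda>_. undefined)) {y n} =
             ennreal (\<Prod>i<n. pmf (K (take i xs)) (xs ! i))" if "n \<le> length xs" for n
    using that
  proof (induction n)
    case 0
    then show ?case
      by (simp add: y_def restrict_def PiM_empty)
  next
    case (Suc n)
    have space: "y n \<in> space (PiM {0..<n} ?M)"
      by (simp add: PiM_eq y_def)
    have take_eq: "map (y n) [0..<n] = take n xs"
      using Suc.prems by (intro nth_equalityI) (auto simp: y_def)
    have "emeasure (IT.C 0 (Suc n) (\<lambda>_. undefined)) {y (Suc n)} =
            (\<integral>\<^sup>+\<omega>. emeasure (IT.eP n \<omega>) {y (Suc n)} \<partial>IT.C 0 n (\<lambda>_. undefined))"
      using sing[of "Suc n"] IT.measurable_eP[of n]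
      by (simp add: emeasure_bind[OF _ _ sing] IT.space_C measurable_cong_sets[OF IT.sets_C refl])
    also have "\<dots> = (\<integral>\<^sup>+\<omega>. ennreal (pmf (K (take n xs)) (xs ! n)) * indicator {y n} \<omega>
                     \<partial>IT.C 0 n (\<lambda>_. undefined))"
    proof (rule nn_integral_cong)
      fix \<omega> assume "\<omega> \<in> space (IT.C 0 n (\<lambda>_. undefined))"
      then have \<omega>: "\<omega> \<in> space (PiM {0..<n} ?M)"
        by (simp add: IT.space_C)
      have "emeasure (IT.eP n \<omega>) {y (Suc n)} =
              emeasure (path_kernel K n \<omega>) {x. fun_upd \<omega> n x = y (Suc n)}"
        by (subst IT.emeasure_eP[OF \<omega> sing])
          (auto intro!: arg_cong2[where f = emeasure] simp: path_kernel_def)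
      also have "{x. fun_upd \<omega> n x = y (Suc n)} = (if \<omega> = y n then {xs ! n} else {})"
      proof -
        have "\<omega> n = undefined"
          using \<omega> by (auto simp: PiM_eq PiE_iff extensional_def)
        then have "fun_upd \<omega> n x = y (Suc n) \<longleftrightarrow> \<omega> = y n \<and> x = xs ! n" for x
          by (auto simp: y_def fun_eq_iff restrict_def less_Suc_eq)
        then show ?thesis by auto
      qed
      also have "emeasure (path_kernel K n \<omega>) \<dots> =
          ennreal (pmf (K (take n xs)) (xs ! n)) * indicator {y n} \<omega>"
        by (simp add: path_kernel_def emeasure_pmf_single take_eq)
      finally show "emeasure (IT.eP n \<omega>) {y (Suc n)} =
          ennreal (pmf (K (take n xs)) (xs ! n)) * indicator {y n} \<omega>" .
    qed
    also have "\<dots> = ennreal (pmf (K (take n xs)) (xs ! n)) *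
                    emeasure (IT.C 0 n (\<lambda>_. undefined)) {y n}"
      using sing[of n] by (intro nn_integral_cmult_indicator) (simp add: IT.sets_C)
    also have "\<dots> = ennreal (\<Prod>i<Suc n. pmf (K (take i xs)) (xs ! i))"
      using Suc by (simp add: ennreal_mult[symmetric] prod_nonneg mult.commute)
    finally show ?case .
  qed
  let ?n = "length xs"
  have emb: "IT.PF.emb UNIV {0..<?n} {y ?n} = {\<omega>. \<forall>i<?n. \<omega> i = xs ! i}"
    by (auto simp: prod_emb_def y_def fun_eq_iff restrict_def space_PiM) metis
  have emb': "IT.PF.emb {0..<?n} {0..<?n} {y ?n} = {y ?n}"
    by (rule prod_emb_id) (simp add: y_def)
  have "emeasure (path_law K) {\<omega>. \<forall>i<?n. \<omega> i = xs ! i} = emeasure (IT.CI {0..<?n}) {y ?n}"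
    unfolding path_law_def emb[symmetric] by (rule IT.lim) (auto intro: sing)
  also have "\<dots> = emeasure (IT.C 0 ?n (\<lambda>_. undefined)) {y ?n}"
    by (subst IT.emeasure_CI[OF subset_refl sing]) (simp only: emb')
  finally show ?thesis
    by (simp add: C measure_def prod_nonneg)
qed

section \<open>Controlled processes with a controller and an adversary\<close>

text \<open>
  A history \<open>(s\<^sub>0, a\<^sub>0, \<dots>, s\<^sub>t\<^sub>-\<^sub>1, a\<^sub>t\<^sub>-\<^sub>1, s\<^sub>t)\<close> is the pair of the list of the first \<open>t\<close>
  state-action pairs and the current state. As the list determines \<open>t\<close>, a sequence
  \<open>(\<pi>\<^sub>0, \<pi>\<^sub>1, \<dots>)\<close> of decision rules is a single function on histories.
\<close>

type_synonym ('s, 'a) history = "('s \<times> 'a) list \<times> 's"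
type_synonym ('s, 'a) policy = "('s, 'a) history \<Rightarrow> 'a pmf"
type_synonym ('s, 'a) adversary = "('s, 'a) history \<Rightarrow> 'a \<Rightarrow> 's pmf"

definition stationary_rules :: "'a pmf set \<Rightarrow> ('s \<Rightarrow> 'a pmf) set" where
  "stationary_rules Q = {\<Delta>. \<forall>s. \<Delta> s \<in> Q}"

text \<open>The product of the sets \<open>P s\<close>; \<open>pmf (p s a) s'\<close> is the transition probability from
  \<open>s\<close> to \<open>s'\<close> under action \<open>a\<close>.\<close>

definition rectangular :: "('s \<Rightarrow> ('a \<Rightarrow> 's pmf) set) \<Rightarrow> ('s \<Rightarrow> 'a \<Rightarrow> 's pmf) set" where
  "rectangular P = {p. \<forall>s. p s \<in> P s}"

definition history_policies :: "'a pmf set \<Rightarrow> ('s, 'a) policy set" where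
  "history_policies Q = {\<pi>. \<forall>h. \<pi> h \<in> Q}"

definition stationary_policies :: "'a pmf set \<Rightarrow> ('s, 'a) policy set" where
  "stationary_policies Q = {\<lambda>h. \<Delta> (snd h) | \<Delta>. \<Delta> \<in> stationary_rules Q}"

definition stationary_adversaries ::
  "('s \<Rightarrow> ('a \<Rightarrow> 's pmf) set) \<Rightarrow> ('s, 'a) adversary set" where
  "stationary_adversaries P = {\<lambda>h. p (snd h) | p. p \<in> rectangular P}"

text \<open>The conditional law of \<open>(X\<^sub>t, A\<^sub>t)\<close> given the list of the previous pairs.\<close>

definition step_kernel ::
  "'s pmf \<Rightarrow> ('s, 'a) policy \<Rightarrow> ('s, 'a) adversary \<Rightarrow> ('s \<times> 'a) list \<Rightarrow> ('s \<times> 'a) pmf" where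
  "step_kernel \<mu> \<pi> \<kappa> xs =
     bind_pmf (if xs = [] then \<mu> else \<kappa> (butlast xs, fst (last xs)) (snd (last xs)))
       (\<lambda>x. map_pmf (Pair x) (\<pi> (xs, x)))"

definition mean_reward ::
  "('s \<Rightarrow> 'a \<Rightarrow> real) \<Rightarrow> 's pmf \<Rightarrow> ('s, 'a) policy \<Rightarrow> ('s, 'a) adversary \<Rightarrow> nat \<Rightarrow> real" where
  "mean_reward r \<mu> \<pi> \<kappa> n =
     (\<integral>\<omega>. (1 / real n) * (\<Sum>k<n. r (fst (\<omega> k)) (snd (\<omega> k))) \<partial>path_law (step_kernel \<mu> \<pi> \<kappa>))"

definition upper_average ::
  "('s \<Rightarrow> 'a \<Rightarrow> real) \<Rightarrow> 's pmf \<Rightarrow> ('s, 'a) policy \<Rightarrow> ('s, 'a) adversary \<Rightarrow> ereal" where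
  "upper_average r \<mu> \<pi> \<kappa> = limsup (\<lambda>n. ereal (mean_reward r \<mu> \<pi> \<kappa> n))"

definition lower_average ::
  "('s \<Rightarrow> 'a \<Rightarrow> real) \<Rightarrow> 's pmf \<Rightarrow> ('s, 'a) policy \<Rightarrow> ('s, 'a) adversary \<Rightarrow> ereal" where
  "lower_average r \<mu> \<pi> \<kappa> = liminf (\<lambda>n. ereal (mean_reward r \<mu> \<pi> \<kappa> n))"

definition upper_value ::
  "('s \<Rightarrow> 'a \<Rightarrow> real) \<Rightarrow> 's pmf \<Rightarrow> ('s, 'a) policy set \<Rightarrow> ('s, 'a) adversary set \<Rightarrow> ereal" where
  "upper_value r \<mu> PI KA = (SUP \<pi>\<in>PI. INF \<kappa>\<in>KA. upper_average r \<mu> \<pi> \<kappa>)"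

definition lower_value ::
  "('s \<Rightarrow> 'a \<Rightarrow> real) \<Rightarrow> 's pmf \<Rightarrow> ('s, 'a) policy set \<Rightarrow> ('s, 'a) adversary set \<Rightarrow> ereal" where
  "lower_value r \<mu> PI KA = (SUP \<pi>\<in>PI. INF \<kappa>\<in>KA. lower_average r \<mu> \<pi> \<kappa>)"

section \<open>Communication structure\<close>

definition induced_chain ::
  "('s \<Rightarrow> 'a \<Rightarrow> 's pmf) \<Rightarrow> ('s \<Rightarrow> 'a pmf) \<Rightarrow> 's \<Rightarrow> 's pmf" where
  "induced_chain p \<Delta> s = bind_pmf (\<Delta> s) (p s)"

lemma pmf_induced_chain:
  fixes p :: "'s \<Rightarrow> 'a::finite \<Rightarrow> 's pmf"
  shows "pmf (induced_chain p \<Delta> s) s' = (\<Sum>a\<in>UNIV. pmf (p s a) s' * pmf (\<Delta> s) a)"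
  unfolding induced_chain_def pmf_bind
  by (subst integral_measure_pmf_real[of UNIV]) auto

definition transition_matrix :: "('s::finite \<Rightarrow> 's pmf) \<Rightarrow> real ^ 's ^ 's" where
  "transition_matrix T = (\<chi> s s'. pmf (T s) s')"

primrec matrix_power :: "real ^ 'n ^ 'n \<Rightarrow> nat \<Rightarrow> real ^ 'n ^ 'n" where
  "matrix_power M 0 = mat 1"
| "matrix_power M (Suc n) = M ** matrix_power M n"

definition chain_law :: "('s \<Rightarrow> 's pmf) \<Rightarrow> 's \<Rightarrow> (nat \<Rightarrow> 's) measure" where
  "chain_law T s = path_law (\<lambda>xs. if xs = [] then return_pmf s else T (last xs))"

text \<open>Transience: started at \<open>s\<close>, the chain returns to \<open>s\<close> with probability less than one.\<close>

definition transient :: "('s \<Rightarrow> 's pmf) \<Rightarrow> 's \<Rightarrow> bool" where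
  "transient T s \<longleftrightarrow> measure (chain_law T s) {\<omega>. \<exists>n\<ge>1. \<omega> n = s} < 1"

definition weakly_communicating_rule ::
  "('s::finite \<Rightarrow> ('a \<Rightarrow> 's pmf) set) \<Rightarrow> ('s \<Rightarrow> 'a pmf) \<Rightarrow> bool" where
  "weakly_communicating_rule P \<Delta> \<longleftrightarrow>
     (\<exists>C. (\<forall>s\<in>C. \<forall>s'\<in>C. \<exists>p\<in>rectangular P. \<exists>N\<ge>1.
             matrix_power (transition_matrix (induced_chain p \<Delta>)) N $ s $ s' > 0) \<and>
          (\<forall>s. s \<notin> C \<longrightarrow> (\<forall>p\<in>rectangular P. transient (induced_chain p \<Delta>) s)))"

definition weakly_communicating_kernel ::
  "'a pmf set \<Rightarrow> ('s::finite \<Rightarrow> 'a \<Rightarrow> 's pmf) \<Rightarrow> bool" where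
  "weakly_communicating_kernel Q p \<longleftrightarrow>
     (\<exists>C. (\<forall>s\<in>C. \<forall>s'\<in>C. \<exists>\<Delta>\<in>stationary_rules Q. \<exists>N\<ge>1.
             matrix_power (transition_matrix (induced_chain p \<Delta>)) N $ s $ s' > 0) \<and>
          (\<forall>s. s \<notin> C \<longrightarrow> (\<forall>\<Delta>\<in>stationary_rules Q. transient (induced_chain p \<Delta>) s)))"

definition weakly_communicating_controller ::
  "'a pmf set \<Rightarrow> ('s::finite \<Rightarrow> ('a \<Rightarrow> 's pmf) set) \<Rightarrow> bool" where
  "weakly_communicating_controller Q P \<longleftrightarrow>
     (\<forall>\<Delta>\<in>stationary_rules Q. weakly_communicating_rule P \<Delta>)"

definition weakly_communicating_adversary ::
  "'a pmf set \<Rightarrow> ('s::finite \<Rightarrow> ('a \<Rightarrow> 's pmf) set) \<Rightarrow> bool" where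
  "weakly_communicating_adversary Q P \<longleftrightarrow>
     (\<forall>p\<in>rectangular P. weakly_communicating_kernel Q p)"

section \<open>Compactness and the average-reward equations\<close>

text \<open>Probability vectors and stochastic kernels as points of Euclidean space.\<close>

definition pmf_vec :: "'a::finite pmf \<Rightarrow> real ^ 'a" where
  "pmf_vec \<phi> = (\<chi> a. pmf \<phi> a)"

definition kernel_vec :: "('a::finite \<Rightarrow> 's::finite pmf) \<Rightarrow> real ^ 's ^ 'a" where
  "kernel_vec q = (\<chi> a s'. pmf (q a) s')"

definition bellman_term ::
  "('s::finite \<Rightarrow> 'a::finite \<Rightarrow> real) \<Rightarrow> ('s \<Rightarrow> real) \<Rightarrow> real \<Rightarrow> 's \<Rightarrow> 'a pmf \<Rightarrow> ('a \<Rightarrow> 's pmf) \<Rightarrow> real"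
  where
  "bellman_term r u \<alpha> s \<phi> q =
     (\<Sum>a\<in>UNIV. \<Sum>s'\<in>UNIV. pmf \<phi> a * pmf (q a) s' * (r s a - \<alpha> + u s'))"

definition sup_inf_solution ::
  "('s::finite \<Rightarrow> 'a::finite \<Rightarrow> real) \<Rightarrow> 'a pmf set \<Rightarrow> ('s \<Rightarrow> ('a \<Rightarrow> 's pmf) set) \<Rightarrow>
     ('s \<Rightarrow> real) \<Rightarrow> real \<Rightarrow> bool" where
  "sup_inf_solution r Q P u \<alpha> \<longleftrightarrow> \<alpha> \<in> {0..1} \<and>
     (\<forall>s. u s = (SUP \<phi>\<in>Q. INF q\<in>P s. bellman_term r u \<alpha> s \<phi> q))"

definition inf_sup_solution ::
  "('s::finite \<Rightarrow> 'a::finite \<Rightarrow> real) \<Rightarrow> 'a pmf set \<Rightarrow> ('s \<Rightarrow> ('a \<Rightarrow> 's pmf) set) \<Rightarrow>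
     ('s \<Rightarrow> real) \<Rightarrow> real \<Rightarrow> bool" where
  "inf_sup_solution r Q P u \<alpha> \<longleftrightarrow> \<alpha> \<in> {0..1} \<and>
     (\<forall>s. u s = (INF q\<in>P s. SUP \<phi>\<in>Q. bellman_term r u \<alpha> s \<phi> q))"

end

theory Submission
  imports Defs
begin

text \<open>
  The equivalence rests on identifying both values: for every initial distribution, and for both the
  limsup and the liminf criterion, the stationary value is \<open>\<alpha>\<^sup>*\<close> (\<open>stationary_values\<close>) and the
  history-dependent value is \<open>\<alpha>'\<close> (\<open>history_values\<close>). The values agree exactly when the constants do.

  For stationary policies this is a drift argument. Along a history, the total reward plus the
  relative value of the current state increases on average by at least, or at most, the constant in
  the equation when the controller, or the adversary, plays an optimal action of the one-step game in each state.
  Compactness provides these actions.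

  A history-dependent controller faces a kernel that is fixed in advance but unknown. A kernel that
  minimizes in the inf-sup equation holds every such policy to \<open>\<alpha>'\<close>. For the lower bound
  the inf-sup equation shows that for every kernel, each state has a pure action whose gain
  \<open>r s a - \<alpha>' + u' s' - u' s\<close> has nonnegative mean. Finding it is a separate bandit problem in each
  state. The greedy policy that plays the action with the largest accumulated gain in the current state solves it: an
  action is only played while its accumulated gain is at least that of the good action, so that no
  accumulated gain falls below the running minimum of the good action's noise by more than one step.
  That minimum is of order \<open>- sqrt n\<close> in expectation, because the reflected random walk has second moment of order \<open>n\<close>.
  As the gains telescope, the average reward is at least \<open>\<alpha>' - O(1 / sqrt n)\<close> (\<open>greedy_policy_expected_reward\<close>).

  Communication enters through the existence of solutions. These are limits of normalized discounted
  solutions (\<open>ergodic_equation_solvable\<close>), and the only obstruction is a nonconstant solution of the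
  equation without reward. Let the outer player of the game fix optimal actions in such a solution. Then the
  states that are best for that player are never left, and the worst ones are not left under a best reply of the
  other player. Both sets contain recurrent states, which lie in the communicating class. The best states
  spread over that class and so meet the worst ones (\<open>communicating_chains_constant\<close>).
\<close>

section \<open>Expected one-step payoffs\<close>

definition payoff ::
  "('a::finite \<Rightarrow> 's::finite \<Rightarrow> real) \<Rightarrow> 'a pmf \<Rightarrow> ('a \<Rightarrow> 's pmf) \<Rightarrow> real" where
  "payoff f \<phi> q = (\<Sum>a\<in>UNIV. \<Sum>s'\<in>UNIV. pmf \<phi> a * pmf (q a) s' * f a s')"

lemma bellman_term_eq_payoff:
  "bellman_term r u \<alpha> s \<phi> q = payoff (\<lambda>a s'. r s a - \<alpha> + u s') \<phi> q"
  by (simp add: bellman_term_def payoff_def)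

lemma payoff_nested:
  "payoff f \<phi> q = (\<Sum>a\<in>UNIV. pmf \<phi> a * (\<Sum>s'\<in>UNIV. pmf (q a) s' * f a s'))"
  by (simp add: payoff_def sum_distrib_left mult.assoc)

lemma payoff_const: "payoff (\<lambda>a s'. d) \<phi> q = d"
  by (simp add: payoff_nested sum_distrib_right[symmetric] sum_pmf_eq_1)

lemma payoff_add: "payoff (\<lambda>a s'. f a s' + g a s') \<phi> q = payoff f \<phi> q + payoff g \<phi> q"
  by (simp add: payoff_def distrib_left sum.distrib)

lemma payoff_cmult: "payoff (\<lambda>a s'. c * f a s') \<phi> q = c * payoff f \<phi> q"
  by (simp add: payoff_def sum_distrib_left mult.left_commute)

lemma payoff_affine: "payoff (\<lambda>a s'. c * f a s' + d) \<phi> q = c * payoff f \<phi> q + d"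
  by (simp only: payoff_add payoff_cmult payoff_const)

lemma payoff_uminus: "payoff (\<lambda>a s'. - f a s') \<phi> q = - payoff f \<phi> q"
  using payoff_cmult[of "-1" f \<phi> q] by simp

lemma payoff_mono: "(\<And>a s'. f a s' \<le> g a s') \<Longrightarrow> payoff f \<phi> q \<le> payoff g \<phi> q"
  unfolding payoff_def by (intro sum_mono mult_left_mono) auto

lemma payoff_return_pmf: "payoff f (return_pmf a) q = (\<Sum>s'\<in>UNIV. pmf (q a) s' * f a s')"
proof -
  have "payoff f (return_pmf a) q =
      (\<Sum>b\<in>UNIV. if b = a then (\<Sum>s'\<in>UNIV. pmf (q a) s' * f a s') else 0)"
    unfolding payoff_nested by (intro sum.cong) (auto simp: indicator_def)
  then show ?thesis by simp
qed

lemma abs_payoff_le: 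
  assumes "\<And>a s'. \<bar>f a s'\<bar> \<le> B" shows "\<bar>payoff f \<phi> q\<bar> \<le> B"
proof -
  have "payoff f \<phi> q \<le> payoff (\<lambda>a s'. B) \<phi> q" "payoff (\<lambda>a s'. - B) \<phi> q \<le> payoff f \<phi> q"
    by (rule payoff_mono; use assms in \<open>simp add: abs_le_iff minus_le_iff\<close>)+
  then show ?thesis by (simp add: payoff_const abs_le_iff)
qed

lemma finite_family_bounded: "\<exists>B. \<forall>a s'. \<bar>f a s' :: real\<bar> \<le> B"
  for f :: "'a::finite \<Rightarrow> 's::finite \<Rightarrow> real"
proof (intro exI allI)
  fix a s'
  show "\<bar>f a s'\<bar> \<le> (\<Sum>a\<in>UNIV. \<Sum>s'\<in>UNIV. \<bar>f a s'\<bar>)"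
    using member_le_sum[of s' UNIV "\<lambda>s'. \<bar>f a s'\<bar>"]
      member_le_sum[of a UNIV "\<lambda>a. \<Sum>s'\<in>UNIV. \<bar>f a s'\<bar>"]
    by (simp add: sum_nonneg)
qed

section \<open>Max-min and min-max values of a one-step game\<close>

lemma cSUP_affine:
  fixes F G :: "'x \<Rightarrow> real"
  assumes "X \<noteq> {}" "\<And>x. x \<in> X \<Longrightarrow> \<bar>G x\<bar> \<le> B" "0 < c"
    and le: "\<And>x. x \<in> X \<Longrightarrow> F x \<le> c * G x + d"
  shows "(SUP x\<in>X. F x) \<le> c * (SUP x\<in>X. G x) + d"
proof (rule cSUP_least[OF \<open>X \<noteq> {}\<close>])
  fix x assume x: "x \<in> X"
  have "bdd_above (G ` X)" using assms(2) by (intro bdd_aboveI2[of _ _ B]) (auto simp: abs_le_iff)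
  then have "G x \<le> (SUP x\<in>X. G x)" using x by (intro cSUP_upper)
  then have "c * G x \<le> c * (SUP x\<in>X. G x)" using \<open>0 < c\<close> by simp
  then show "F x \<le> c * (SUP x\<in>X. G x) + d" using le[OF x] by linarith
qed

lemma cINF_affine:
  fixes F G :: "'x \<Rightarrow> real"
  assumes "X \<noteq> {}" "\<And>x. x \<in> X \<Longrightarrow> \<bar>F x\<bar> \<le> B" "0 < c"
    and le: "\<And>x. x \<in> X \<Longrightarrow> F x \<le> c * G x + d"
  shows "(INF x\<in>X. F x) \<le> c * (INF x\<in>X. G x) + d"
proof -
  have "((INF x\<in>X. F x) - d) / c \<le> (INF x\<in>X. G x)"
  proof (rule cINF_greatest[OF \<open>X \<noteq> {}\<close>])
    fix x assume x: "x \<in> X"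
    have "bdd_below (F ` X)" using assms(2) by (intro bdd_belowI2[of _ "- B"]) (auto simp: abs_le_iff minus_le_iff)
    then have "(INF x\<in>X. F x) \<le> F x" using x by (intro cINF_lower)
    then show "((INF x\<in>X. F x) - d) / c \<le> G x"
      using le[OF x] \<open>0 < c\<close> by (simp add: pos_divide_le_eq mult.commute)
  qed
  then show ?thesis using \<open>0 < c\<close> by (simp add: pos_divide_le_eq mult.commute)
qed

lemma abs_cSUP_le: "X \<noteq> {} \<Longrightarrow> (\<And>x. x \<in> X \<Longrightarrow> \<bar>F x :: real\<bar> \<le> B) \<Longrightarrow> \<bar>SUP x\<in>X. F x\<bar> \<le> B"
  by (rule cSup_abs_le) auto

lemma abs_cINF_le:
  assumes "X \<noteq> {}" "\<And>x. x \<in> X \<Longrightarrow> \<bar>F x :: real\<bar> \<le> B"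
  shows "\<bar>INF x\<in>X. F x\<bar> \<le> B"
proof -
  have "\<bar>SUP x\<in>X. - F x\<bar> \<le> B" using assms by (intro abs_cSUP_le) auto
  then show ?thesis by (simp add: Inf_real_def image_image)
qed

text \<open>
  Monotonicity, invariance under adding constants and positive homogeneity of a value functional,
  in one inequality. It is the only property of the two value operators that the existence proof
  uses, so that proof treats max-min and min-max at once.
\<close>

definition affinely_monotone :: "(('a \<Rightarrow> 's \<Rightarrow> real) \<Rightarrow> real) \<Rightarrow> bool" where
  "affinely_monotone V \<longleftrightarrow>
     (\<forall>f g c d. 0 < c \<longrightarrow> (\<forall>a s. f a s \<le> c * g a s + d) \<longrightarrow> V f \<le> c * V g + d)"

lemma affinely_monotone_SUP_INF_payoff:
  fixes Q :: "'a::finite pmf set" and Ps :: "('a \<Rightarrow> 's::finite pmf) set"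
  assumes "Q \<noteq> {}" "Ps \<noteq> {}"
  shows "affinely_monotone (\<lambda>f. SUP \<phi>\<in>Q. INF q\<in>Ps. payoff f \<phi> q)"
  unfolding affinely_monotone_def
proof (intro allI impI)
  fix f g :: "'a \<Rightarrow> 's \<Rightarrow> real" and c d :: real
  assume c: "0 < c" and le: "\<forall>a s. f a s \<le> c * g a s + d"
  obtain B where B: "\<bar>f a s\<bar> \<le> B" for a s using finite_family_bounded[of f] by blast
  obtain B' where B': "\<bar>g a s\<bar> \<le> B'" for a s using finite_family_bounded[of g] by blast
  have "payoff f \<phi> q \<le> c * payoff g \<phi> q + d" for \<phi> q
    unfolding payoff_affine[symmetric] using le by (intro payoff_mono) auto
  then show "(SUP \<phi>\<in>Q. INF q\<in>Ps. payoff f \<phi> q) \<le> c * (SUP \<phi>\<in>Q. INF q\<in>Ps. payoff g \<phi> q) + d"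
    by (intro cSUP_affine[where B = B'] cINF_affine[where B = B] abs_cINF_le abs_payoff_le assms c B B')
qed

lemma affinely_monotone_INF_SUP_payoff:
  fixes Q :: "'a::finite pmf set" and Ps :: "('a \<Rightarrow> 's::finite pmf) set"
  assumes "Q \<noteq> {}" "Ps \<noteq> {}"
  shows "affinely_monotone (\<lambda>f. INF q\<in>Ps. SUP \<phi>\<in>Q. payoff f \<phi> q)"
  unfolding affinely_monotone_def
proof (intro allI impI)
  fix f g :: "'a \<Rightarrow> 's \<Rightarrow> real" and c d :: real
  assume c: "0 < c" and le: "\<forall>a s. f a s \<le> c * g a s + d"
  obtain B where B: "\<bar>f a s\<bar> \<le> B" for a s using finite_family_bounded[of f] by blast
  obtain B' where B': "\<bar>g a s\<bar> \<le> B'" for a s using finite_family_bounded[of g] by blast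
  have "payoff f \<phi> q \<le> c * payoff g \<phi> q + d" for \<phi> q
    unfolding payoff_affine[symmetric] using le by (intro payoff_mono) auto
  then show "(INF q\<in>Ps. SUP \<phi>\<in>Q. payoff f \<phi> q) \<le> c * (INF q\<in>Ps. SUP \<phi>\<in>Q. payoff g \<phi> q) + d"
    by (intro cINF_affine[where B = B] cSUP_affine[where B = B'] abs_cSUP_le abs_payoff_le assms c B B')
qed

text \<open>
  The inner infimum of continuous functions is only upper semicontinuous in the outer variable, but
  that suffices: the limit of a maximizing sequence inherits, for each \<open>y\<close> separately, the lower
  bound that the sequence has.
\<close>

lemma compact_attains_SUP_INF:
  fixes e :: "'x \<Rightarrow> 'v::metric_space" and F :: "'v \<Rightarrow> 'y \<Rightarrow> real"
  assumes compact: "compact (e ` X)" and "X \<noteq> {}" "Y \<noteq> {}"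
    and cont: "\<And>y. y \<in> Y \<Longrightarrow> continuous_on (e ` X) (\<lambda>v. F v y)"
    and bound: "\<And>x y. x \<in> X \<Longrightarrow> y \<in> Y \<Longrightarrow> \<bar>F (e x) y\<bar> \<le> B"
  shows "\<exists>x\<in>X. \<forall>y\<in>Y. (SUP x\<in>X. INF y\<in>Y. F (e x) y) \<le> F (e x) y"
proof -
  define S where "S = (SUP x\<in>X. INF y\<in>Y. F (e x) y)"
  have "\<exists>x\<in>X. S - 1 / real (Suc n) < (INF y\<in>Y. F (e x) y)" for n
  proof -
    have "S - 1 / real (Suc n) < (SUP x\<in>X. INF y\<in>Y. F (e x) y)" by (simp add: S_def)
    from less_cSupD[OF _ this] \<open>X \<noteq> {}\<close> show ?thesis by auto
  qed
  then obtain xs where xs: "\<And>n. xs n \<in> X" "\<And>n. S - 1 / real (Suc n) < (INF y\<in>Y. F (e (xs n)) y)"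
    by metis
  have "\<forall>n. (e \<circ> xs) n \<in> e ` X" using xs by auto
  then obtain l k where l: "l \<in> e ` X" and k: "strict_mono k" and lim: "((e \<circ> xs) \<circ> k) \<longlonglongrightarrow> l"
    using compact unfolding compact_def by (elim allE[of _ "e \<circ> xs"] impE) blast+
  from l obtain x where x: "x \<in> X" "l = e x" by auto
  have "S \<le> F (e x) y" if y: "y \<in> Y" for y
  proof (rule LIMSEQ_le)
    have "(\<lambda>n. 1 / real (Suc n)) \<longlonglongrightarrow> 0" by (rule lim_1_over_n[THEN LIMSEQ_Suc])
    from LIMSEQ_subseq_LIMSEQ[OF this k]
    have "(\<lambda>n. S - 1 / real (Suc (k n))) \<longlonglongrightarrow> S - 0" by (intro tendsto_intros) (simp add: o_def)
    then show "(\<lambda>n. S - 1 / real (Suc (k n))) \<longlonglongrightarrow> S" by simp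
    show "(\<lambda>n. F (e (xs (k n))) y) \<longlonglongrightarrow> F (e x) y"
      using continuous_on_tendsto_compose[OF cont[OF y], of "(e \<circ> xs) \<circ> k" l sequentially] lim l xs x
      by auto
    show "\<exists>N. \<forall>n\<ge>N. S - 1 / real (Suc (k n)) \<le> F (e (xs (k n))) y"
    proof (intro exI allI impI)
      fix n
      have "bdd_below ((\<lambda>y. F (e (xs (k n))) y) ` Y)"
        using bound xs by (intro bdd_belowI2[of _ "- B"]) (auto simp: abs_le_iff minus_le_iff)
      then have "(INF y\<in>Y. F (e (xs (k n))) y) \<le> F (e (xs (k n))) y" using y by (intro cINF_lower)
      then show "S - 1 / real (Suc (k n)) \<le> F (e (xs (k n))) y" using xs(2)[of "k n"] by linarith
    qed
  qed
  then show ?thesis using x unfolding S_def by blast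
qed

lemma compact_attains_INF_SUP:
  fixes e :: "'x \<Rightarrow> 'v::metric_space" and F :: "'v \<Rightarrow> 'y \<Rightarrow> real"
  assumes "compact (e ` X)" and "X \<noteq> {}" "Y \<noteq> {}"
    and cont: "\<And>y. y \<in> Y \<Longrightarrow> continuous_on (e ` X) (\<lambda>v. F v y)"
    and bound: "\<And>x y. x \<in> X \<Longrightarrow> y \<in> Y \<Longrightarrow> \<bar>F (e x) y\<bar> \<le> B"
  shows "\<exists>x\<in>X. \<forall>y\<in>Y. F (e x) y \<le> (INF x\<in>X. SUP y\<in>Y. F (e x) y)"
proof -
  have "(INF y\<in>Y. - F (e x) y) = - (SUP y\<in>Y. F (e x) y)" for x
    by (simp add: Inf_real_def image_image)
  then have "(SUP x\<in>X. INF y\<in>Y. - F (e x) y) = - (INF x\<in>X. SUP y\<in>Y. F (e x) y)"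
    by (simp add: Inf_real_def image_image)
  moreover have "\<exists>x\<in>X. \<forall>y\<in>Y. (SUP x\<in>X. INF y\<in>Y. - F (e x) y) \<le> - F (e x) y"
    by (rule compact_attains_SUP_INF[of e X Y "\<lambda>v y. - F v y" B])
      (use assms in \<open>auto intro: continuous_on_minus\<close>)
  ultimately show ?thesis by auto
qed

lemma SUP_INF_payoff_attained:
  fixes Q :: "'a::finite pmf set" and Ps :: "('a \<Rightarrow> 's::finite pmf) set"
  assumes "compact (pmf_vec ` Q)" "Q \<noteq> {}" "Ps \<noteq> {}"
  shows "\<exists>\<phi>\<in>Q. \<forall>q\<in>Ps. (SUP \<phi>\<in>Q. INF q\<in>Ps. payoff f \<phi> q) \<le> payoff f \<phi> q"
proof -
  define F where "F v q = (\<Sum>a\<in>UNIV. \<Sum>s'\<in>UNIV. v $ a * pmf (q a) s' * f a s')"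
    for v :: "real ^ 'a" and q :: "'a \<Rightarrow> 's pmf"
  have eq: "payoff f \<phi> q = F (pmf_vec \<phi>) q" for \<phi> q by (simp add: F_def payoff_def pmf_vec_def)
  obtain B where B: "\<bar>f a s\<bar> \<le> B" for a s using finite_family_bounded[of f] by blast
  note bound = abs_payoff_le[of f B, OF B, unfolded eq F_def]
  show ?thesis unfolding eq
    using assms by (intro compact_attains_SUP_INF[where B = B])
      (auto simp: F_def intro!: continuous_intros bound)
qed

lemma INF_SUP_payoff_attained:
  fixes Q :: "'a::finite pmf set" and Ps :: "('a \<Rightarrow> 's::finite pmf) set"
  assumes "compact (kernel_vec ` Ps)" "Q \<noteq> {}" "Ps \<noteq> {}"
  shows "\<exists>q\<in>Ps. \<forall>\<phi>\<in>Q. payoff f \<phi> q \<le> (INF q\<in>Ps. SUP \<phi>\<in>Q. payoff f \<phi> q)"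
proof -
  define F where "F v \<phi> = (\<Sum>a\<in>UNIV. \<Sum>s'\<in>UNIV. pmf \<phi> a * v $ a $ s' * f a s')"
    for v :: "real ^ 's ^ 'a" and \<phi> :: "'a pmf"
  have eq: "payoff f \<phi> q = F (kernel_vec q) \<phi>" for \<phi> q by (simp add: F_def payoff_def kernel_vec_def)
  obtain B where B: "\<bar>f a s\<bar> \<le> B" for a s using finite_family_bounded[of f] by blast
  note bound = abs_payoff_le[of f B, OF B, unfolded eq F_def]
  show ?thesis unfolding eq
    using assms by (intro compact_attains_INF_SUP[where B = B])
      (auto simp: F_def intro!: continuous_intros bound)
qed

text \<open>
  Against a fixed mixed action the adversary has an optimal reply, and it pays at most the max-min
  value.
\<close>

lemma payoff_best_reply_adversary:
  fixes Q :: "'a::finite pmf set" and Ps :: "('a \<Rightarrow> 's::finite pmf) set"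
  assumes "compact (kernel_vec ` Ps)" "Ps \<noteq> {}" "\<phi> \<in> Q"
  shows "\<exists>q\<in>Ps. payoff f \<phi> q \<le> (SUP \<phi>\<in>Q. INF q\<in>Ps. payoff f \<phi> q)"
proof -
  obtain q where q: "q \<in> Ps" "payoff f \<phi> q \<le> (INF q\<in>Ps. payoff f \<phi> q)"
    using INF_SUP_payoff_attained[OF assms(1) _ assms(2), of "{\<phi>}" f] by auto
  obtain B where B: "\<bar>f a s\<bar> \<le> B" for a s using finite_family_bounded[of f] by blast
  have "bdd_above ((\<lambda>\<phi>. INF q\<in>Ps. payoff f \<phi> q) ` Q)"
    using abs_cINF_le[OF assms(2) abs_payoff_le[of f B], OF B] by (intro bdd_aboveI2[of _ _ B]) (simp add: abs_le_iff)
  then have "(INF q\<in>Ps. payoff f \<phi> q) \<le> (SUP \<phi>\<in>Q. INF q\<in>Ps. payoff f \<phi> q)"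
    using assms(3) by (intro cSUP_upper)
  with q show ?thesis by force
qed

lemma payoff_best_reply_controller:
  fixes Q :: "'a::finite pmf set" and Ps :: "('a \<Rightarrow> 's::finite pmf) set"
  assumes "compact (pmf_vec ` Q)" "Q \<noteq> {}" "q \<in> Ps"
  shows "\<exists>\<phi>\<in>Q. (INF q\<in>Ps. SUP \<phi>\<in>Q. payoff f \<phi> q) \<le> payoff f \<phi> q"
proof -
  obtain \<phi> where \<phi>: "\<phi> \<in> Q" "(SUP \<phi>\<in>Q. payoff f \<phi> q) \<le> payoff f \<phi> q"
    using SUP_INF_payoff_attained[OF assms(1,2), of "{q}" f] by auto
  obtain B where B: "\<bar>f a s\<bar> \<le> B" for a s using finite_family_bounded[of f] by blast
  have "bdd_below ((\<lambda>q. SUP \<phi>\<in>Q. payoff f \<phi> q) ` Ps)"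
    using abs_cSUP_le[OF assms(2) abs_payoff_le[of f B], OF B]
    by (intro bdd_belowI2[of _ "- B"]) (simp add: abs_le_iff minus_le_iff)
  then have "(INF q\<in>Ps. SUP \<phi>\<in>Q. payoff f \<phi> q) \<le> (SUP \<phi>\<in>Q. payoff f \<phi> q)"
    using assms(3) by (intro cINF_lower)
  with \<phi> show ?thesis by force
qed

text \<open>
  The payoff is linear in the mixed action, so a pure action does at least as well. Since the
  Dirac measures are admissible, the controller has only finitely many candidates for a good reply
  in each state, which is what makes an unknown kernel learnable.
\<close>

lemma payoff_le_some_action: "\<exists>a. payoff f \<phi> q \<le> payoff f (return_pmf a) q"
proof (rule ccontr)
  assume "\<not> ?thesis"
  then have lt: "payoff f (return_pmf a) q < payoff f \<phi> q" for a by (simp add: not_le)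
  have "payoff f \<phi> q = (\<Sum>a\<in>UNIV. pmf \<phi> a * payoff f (return_pmf a) q)"
    by (simp add: payoff_nested[of f \<phi>] payoff_return_pmf)
  also have "\<dots> < (\<Sum>a\<in>UNIV. pmf \<phi> a * payoff f \<phi> q)"
  proof (rule sum_strict_mono_ex1)
    show "\<forall>a\<in>UNIV. pmf \<phi> a * payoff f (return_pmf a) q \<le> pmf \<phi> a * payoff f \<phi> q"
      using lt[THEN less_imp_le] by (auto intro!: mult_left_mono)
    obtain a where "a \<in> set_pmf \<phi>" using set_pmf_not_empty[of \<phi>] by blast
    then have "pmf \<phi> a * payoff f (return_pmf a) q < pmf \<phi> a * payoff f \<phi> q"
      using lt by (simp add: pmf_positive)
    then show "\<exists>a\<in>UNIV. pmf \<phi> a * payoff f (return_pmf a) q < pmf \<phi> a * payoff f \<phi> q"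
      by blast
  qed simp
  also have "\<dots> = payoff f \<phi> q" by (simp add: sum_distrib_right[symmetric] sum_pmf_eq_1)
  finally show False by simp
qed

section \<open>Ergodic equations for affinely monotone operators\<close>

lemma affinely_monotoneD:
  "affinely_monotone V \<Longrightarrow> 0 < c \<Longrightarrow> (\<And>a s. f a s \<le> c * g a s + d) \<Longrightarrow> V f \<le> c * V g + d"
  by (auto simp: affinely_monotone_def)

lemma affinely_monotone_affine:
  assumes V: "affinely_monotone V" and c: "0 < c"
  shows "V (\<lambda>a s. c * f a s + d) = c * V f + d"
proof (rule antisym)
  show "V (\<lambda>a s. c * f a s + d) \<le> c * V f + d"
    using affinely_monotoneD[OF V c] by simp
  have "V f \<le> (1 / c) * V (\<lambda>a s. c * f a s + d) + (- d / c)"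
    using c by (intro affinely_monotoneD[OF V]) (auto simp: field_simps)
  then show "c * V f + d \<le> V (\<lambda>a s. c * f a s + d)" using c by (simp add: field_simps)
qed

lemma affinely_monotone_const:
  assumes V: "affinely_monotone V"
  shows "V (\<lambda>a s. d) = d"
  using affinely_monotone_affine[OF V, of 2 "\<lambda>a s. d" "- d"] by simp

lemma affinely_monotone_mono:
  assumes V: "affinely_monotone V" and "\<And>a s. f a s \<le> g a s"
  shows "V f \<le> V g"
  using affinely_monotoneD[OF V, of 1 f g 0] assms(2) by simp

text \<open>
  An affinely monotone functional is Lipschitz with constant one for the supremum norm, which the
  sum of the absolute values dominates.
\<close>

lemma affinely_monotone_tendsto:
  fixes V :: "('a::finite \<Rightarrow> 's::finite \<Rightarrow> real) \<Rightarrow> real"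
  assumes V: "affinely_monotone V"
    and lim: "\<And>a s. ((\<lambda>x. f x a s) \<longlongrightarrow> g a s) F"
  shows "((\<lambda>x. V (f x)) \<longlongrightarrow> V g) F"
proof -
  define D where "D h k = (\<Sum>a\<in>UNIV. \<Sum>s\<in>UNIV. \<bar>h a s - k a s\<bar>)" for h k :: "'a \<Rightarrow> 's \<Rightarrow> real"
  have le_D: "h a s \<le> 1 * k a s + D h k" for h k a s
  proof -
    have "\<bar>h a s - k a s\<bar> \<le> D h k"
      unfolding D_def
      using member_le_sum[of s UNIV "\<lambda>s. \<bar>h a s - k a s\<bar>"]
        member_le_sum[of a UNIV "\<lambda>a. \<Sum>s\<in>UNIV. \<bar>h a s - k a s\<bar>"]
      by (simp add: sum_nonneg)
    then show ?thesis by simp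
  qed
  have D_commute: "D h k = D k h" for h k by (simp add: D_def abs_minus_commute)
  have V_le: "V h \<le> 1 * V k + D h k" for h k
    by (rule affinely_monotoneD[OF V _ le_D]) simp
  have "\<bar>V h - V k\<bar> \<le> D h k" for h k
    using V_le[of h k] V_le[of k h] D_commute[of k h] by linarith
  then have le: "\<forall>\<^sub>F x in F. norm (V (f x) - V g) \<le> D (f x) g" by simp
  have "((\<lambda>x. D (f x) g) \<longlongrightarrow> (\<Sum>a\<in>UNIV. \<Sum>s\<in>UNIV. \<bar>g a s - g a s\<bar>)) F"
    unfolding D_def by (intro tendsto_intros lim)
  then have "((\<lambda>x. D (f x) g) \<longlongrightarrow> 0) F" by simp
  with le have "((\<lambda>x. V (f x) - V g) \<longlongrightarrow> 0) F" by (rule Lim_null_comparison)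
  then show ?thesis by (simp add: LIM_zero_iff)
qed

text \<open>
  This is the discounted equation with discount factor \<open>1 - \<epsilon>\<close>, whose solution is scaled by \<open>\<epsilon>\<close> so
  that it stays in the unit cube for all \<open>\<epsilon>\<close>. The right-hand side is a continuous map of the cube into
  itself, so that Brouwer's theorem applies.
\<close>

lemma discounted_equation_solvable:
  fixes V :: "'s::finite \<Rightarrow> ('a::finite \<Rightarrow> 's \<Rightarrow> real) \<Rightarrow> real" and r :: "'s \<Rightarrow> 'a \<Rightarrow> real"
  assumes V: "\<And>s. affinely_monotone (V s)" and r: "\<And>s a. 0 \<le> r s a \<and> r s a \<le> 1"
    and \<epsilon>: "0 < \<epsilon>" "\<epsilon> < 1"
  shows "\<exists>x. \<forall>s. 0 \<le> x s \<and> x s \<le> 1 \<and> x s = V s (\<lambda>a s'. \<epsilon> * r s a + (1 - \<epsilon>) * x s')"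
proof -
  define F where "F x = (\<chi> s. V s (\<lambda>a s'. \<epsilon> * r s a + (1 - \<epsilon>) * x $ s'))" for x :: "real ^ 's"
  define K where "K = (cbox 0 1 :: (real ^ 's) set)"
  have K_iff: "x \<in> K \<longleftrightarrow> (\<forall>s. 0 \<le> x $ s \<and> x $ s \<le> 1)" for x
    by (auto simp: K_def mem_box_cart)
  have "\<exists>x\<in>K. F x = x"
  proof (rule brouwer[of K F])
    show "compact K" "convex K" by (simp_all add: K_def)
    have "0 \<in> K" by (simp add: K_iff)
    then show "K \<noteq> {}" by blast
    show "continuous_on K F"
      unfolding F_def continuous_on_def
      by (intro ballI tendsto_vec_lambda affinely_monotone_tendsto[OF V] tendsto_intros)
    show "F \<in> K \<rightarrow> K"
    proof
      fix x assume x: "x \<in> K"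
      have range: "0 \<le> \<epsilon> * r s a + (1 - \<epsilon>) * x $ s'" "\<epsilon> * r s a + (1 - \<epsilon>) * x $ s' \<le> 1" for s a s'
      proof -
        show "0 \<le> \<epsilon> * r s a + (1 - \<epsilon>) * x $ s'" using x r \<epsilon> by (simp add: K_iff)
        have "\<epsilon> * r s a \<le> \<epsilon> * 1" "(1 - \<epsilon>) * x $ s' \<le> (1 - \<epsilon>) * 1"
          using x r \<epsilon> by (auto simp: K_iff intro!: mult_left_mono)
        then show "\<epsilon> * r s a + (1 - \<epsilon>) * x $ s' \<le> 1" by simp
      qed
      show "F x \<in> K"
        unfolding K_iff F_def
        using affinely_monotone_mono[OF V, of "\<lambda>a s'. 0"] affinely_monotone_mono[OF V, of _ "\<lambda>a s'. 1"]
          range affinely_monotone_const[OF V] by simp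
    qed
  qed blast
  then obtain x where "x \<in> K" "F x = x" by (elim bexE)
  have "x $ s = V s (\<lambda>a s'. \<epsilon> * r s a + (1 - \<epsilon>) * x $ s')" for s
    using arg_cong[OF \<open>F x = x\<close>, of "\<lambda>y. y $ s"] unfolding F_def vec_lambda_beta by (rule sym)
  moreover have "0 \<le> x $ s \<and> x $ s \<le> 1" for s using \<open>x \<in> K\<close> by (simp add: K_iff)
  ultimately show ?thesis by (intro exI[of _ "\<lambda>s. x $ s"] allI conjI) blast+
qed

text \<open>
  Vanishing discount needs a bound on the oscillation of the discounted solution. Instead of
  proving one, the solution is shifted to have minimum \<open>0\<close> and divided by its oscillation plus \<open>\<epsilon>\<close>.
  All quantities then range over a compact set, and the weight \<open>\<tau>\<close> of the reward records how much
  was divided by: the oscillation of \<open>w\<close> is exactly \<open>1 - \<tau>\<close>. The double sum is a bound on the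
  oscillation that passes to limits.
\<close>

lemma normalized_discounted_equation_solvable:
  fixes V :: "'s::finite \<Rightarrow> ('a::finite \<Rightarrow> 's \<Rightarrow> real) \<Rightarrow> real" and r :: "'s \<Rightarrow> 'a \<Rightarrow> real"
  assumes V: "\<And>s. affinely_monotone (V s)" and r: "\<And>s a. 0 \<le> r s a \<and> r s a \<le> 1"
    and \<epsilon>: "0 < \<epsilon>" "\<epsilon> < 1"
  shows "\<exists>w \<tau> m. (\<forall>s. 0 \<le> w s \<and> w s \<le> 1) \<and> 0 \<le> \<tau> \<and> \<tau> \<le> 1 \<and> 0 \<le> m \<and> m \<le> 1 \<and>
    1 - \<tau> \<le> (\<Sum>s\<in>UNIV. \<Sum>s'\<in>UNIV. \<bar>w s - w s'\<bar>) \<and>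
    (\<forall>s. w s + \<tau> * m = V s (\<lambda>a s'. \<tau> * r s a + (1 - \<epsilon>) * w s'))"
proof -
  obtain x where x': "\<forall>s. 0 \<le> x s \<and> x s \<le> 1 \<and> x s = V s (\<lambda>a s'. \<epsilon> * r s a + (1 - \<epsilon>) * x s')"
    using discounted_equation_solvable[OF V r \<epsilon>] by (rule exE)
  note x = x'[rule_format, THEN conjunct1] x'[rule_format, THEN conjunct2, THEN conjunct1]
    x'[rule_format, THEN conjunct2, THEN conjunct2]
  have "Min (range x) \<in> range x" "Max (range x) \<in> range x" by (auto intro: Min_in Max_in)
  then obtain lo hi where lo_eq: "x lo = Min (range x)" and hi_eq: "x hi = Max (range x)" by (metis imageE)
  have lo: "x lo \<le> x s" and hi: "x s \<le> x hi" for s by (simp_all add: lo_eq hi_eq)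
  define D where "D = x hi - x lo + \<epsilon>"
  have D: "D > 0" using lo[of hi] \<epsilon> by (simp add: D_def)
  define w where "w s = (x s - x lo) / D" for s
  define \<tau> where "\<tau> = \<epsilon> / D"
  have osc: "1 - \<tau> = w hi - w lo" using D by (simp add: \<tau>_def w_def field_simps) (simp add: D_def)
  have "w s + \<tau> * x lo = V s (\<lambda>a s'. \<tau> * r s a + (1 - \<epsilon>) * w s')" for s
  proof -
    have "V s (\<lambda>a s'. \<tau> * r s a + (1 - \<epsilon>) * w s') =
        V s (\<lambda>a s'. (1 / D) * (\<epsilon> * r s a + (1 - \<epsilon>) * x s') + (- (1 - \<epsilon>) * x lo / D))"
      using D by (intro arg_cong[where f = "V s"] ext) (simp add: \<tau>_def w_def field_simps)
    also have "\<dots> = (1 / D) * x s + (- (1 - \<epsilon>) * x lo / D)"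
      using D by (subst affinely_monotone_affine[OF V]) (simp_all add: x(3)[symmetric])
    also have "\<dots> = w s + \<tau> * x lo" using D by (simp add: \<tau>_def w_def field_simps)
    finally show ?thesis by simp
  qed
  moreover have "0 \<le> w s \<and> w s \<le> 1" for s
    using D lo[of s] hi[of s] \<epsilon> by (auto simp: w_def D_def)
  moreover have "0 \<le> \<tau>" "\<tau> \<le> 1" using D \<epsilon> lo[of hi] by (auto simp: \<tau>_def D_def)
  moreover have "1 - \<tau> \<le> (\<Sum>s\<in>UNIV. \<Sum>s'\<in>UNIV. \<bar>w s - w s'\<bar>)"
    unfolding osc
    using member_le_sum[of lo UNIV "\<lambda>s'. \<bar>w hi - w s'\<bar>"]
      member_le_sum[of hi UNIV "\<lambda>s. \<Sum>s'\<in>UNIV. \<bar>w s - w s'\<bar>"]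
    by (simp add: sum_nonneg)
  ultimately show ?thesis using x by blast
qed

text \<open>
  A limit point of the normalized solutions as \<open>\<epsilon> \<rightarrow> 0\<close> satisfies \<open>w s + \<tau> m = V s (\<tau> r + w)\<close>. If \<open>\<tau> > 0\<close>,
  dividing by \<open>\<tau>\<close> gives the claim. If \<open>\<tau> = 0\<close>, the limit is a fixed point of \<open>V\<close> without reward and hence
  constant, although its oscillation is at least \<open>1 - \<tau> = 1\<close>. So the discounted solutions have bounded
  oscillation exactly because the reward-free equation has constant solutions only.
\<close>

theorem ergodic_equation_solvable:
  fixes V :: "'s::finite \<Rightarrow> ('a::finite \<Rightarrow> 's \<Rightarrow> real) \<Rightarrow> real" and r :: "'s \<Rightarrow> 'a \<Rightarrow> real"
  assumes V: "\<And>s. affinely_monotone (V s)" and r: "\<And>s a. 0 \<le> r s a \<and> r s a \<le> 1"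
    and const: "\<And>w s s'. (\<And>s. w s = V s (\<lambda>a s'. w s')) \<Longrightarrow> w s = w s'"
  shows "\<exists>u \<alpha>. \<alpha> \<in> {0..1} \<and> (\<forall>s. u s = V s (\<lambda>a s'. r s a - \<alpha> + u s'))"
proof -
  define \<epsilon> where "\<epsilon> n = 1 / real (Suc (Suc n))" for n
  have \<epsilon>_lim: "\<epsilon> \<longlonglongrightarrow> 0" unfolding \<epsilon>_def by (intro LIMSEQ_Suc lim_1_over_n)
  have "0 < \<epsilon> n \<and> \<epsilon> n < 1" for n by (auto simp: \<epsilon>_def)
  then have "\<forall>n. \<exists>w \<tau> m. (\<forall>s. 0 \<le> w s \<and> w s \<le> 1) \<and> 0 \<le> \<tau> \<and> \<tau> \<le> 1 \<and> 0 \<le> m \<and> m \<le> 1 \<and>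
    1 - \<tau> \<le> (\<Sum>s\<in>UNIV. \<Sum>s'\<in>UNIV. \<bar>w s - w s'\<bar>) \<and>
    (\<forall>s. w s + \<tau> * m = V s (\<lambda>a s'. \<tau> * r s a + (1 - \<epsilon> n) * w s'))"
    by (intro allI normalized_discounted_equation_solvable V r) auto
  then obtain w \<tau> m where w: "\<And>n s. 0 \<le> w n s" "\<And>n s. w n s \<le> 1"
    and \<tau>: "\<And>n. 0 \<le> \<tau> n" "\<And>n. \<tau> n \<le> 1" and m: "\<And>n. 0 \<le> m n" "\<And>n. m n \<le> 1"
    and osc: "\<And>n. 1 - \<tau> n \<le> (\<Sum>s\<in>UNIV. \<Sum>s'\<in>UNIV. \<bar>w n s - w n s'\<bar>)"
    and eq: "\<And>n s. w n s + \<tau> n * m n = V s (\<lambda>a s'. \<tau> n * r s a + (1 - \<epsilon> n) * w n s')"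
    by metis
  define K where "K = (cbox 0 1 :: (real ^ 's) set) \<times> {0..1::real} \<times> {0..1::real}"
  define z where "z n = ((\<chi> s. w n s), \<tau> n, m n)" for n
  have "compact K" unfolding K_def by (intro compact_Times compact_cbox compact_Icc)
  moreover have "\<forall>n. z n \<in> K" using w \<tau> m by (simp add: z_def K_def mem_box_cart)
  ultimately obtain l k where l: "l \<in> K" and k: "strict_mono k" and lim: "(z \<circ> k) \<longlonglongrightarrow> l"
    unfolding compact_def by (elim allE[of _ z] impE) blast+
  define wl where "wl s = fst l $ s" for s
  define \<tau>l where "\<tau>l = fst (snd l)"
  define ml where "ml = snd (snd l)"
  have w_lim: "(\<lambda>n. w (k n) s) \<longlonglongrightarrow> wl s" for s
    using tendsto_vec_nth[OF tendsto_fst[OF lim], of s] by (simp add: z_def wl_def)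
  have \<tau>_lim: "(\<lambda>n. \<tau> (k n)) \<longlonglongrightarrow> \<tau>l"
    using tendsto_fst[OF tendsto_snd[OF lim]] by (simp add: z_def \<tau>l_def)
  have m_lim: "(\<lambda>n. m (k n)) \<longlonglongrightarrow> ml"
    using tendsto_snd[OF tendsto_snd[OF lim]] by (simp add: z_def ml_def)
  have \<epsilon>_k: "(\<lambda>n. \<epsilon> (k n)) \<longlonglongrightarrow> 0"
    using LIMSEQ_subseq_LIMSEQ[OF \<epsilon>_lim k] by (simp add: o_def)
  have bounds: "0 \<le> \<tau>l" "0 \<le> ml" "ml \<le> 1"
    using l by (auto simp: K_def \<tau>l_def ml_def)
  have eq_l: "wl s + \<tau>l * ml = V s (\<lambda>a s'. \<tau>l * r s a + wl s')" for s
  proof (rule LIMSEQ_unique)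
    show "(\<lambda>n. w (k n) s + \<tau> (k n) * m (k n)) \<longlonglongrightarrow> wl s + \<tau>l * ml"
      by (intro tendsto_intros w_lim \<tau>_lim m_lim)
    have "(\<lambda>n. \<tau> (k n) * r s a + (1 - \<epsilon> (k n)) * w (k n) s') \<longlonglongrightarrow> \<tau>l * r s a + (1 - 0) * wl s'" for a s'
      by (intro tendsto_intros w_lim \<tau>_lim \<epsilon>_k)
    then show "(\<lambda>n. w (k n) s + \<tau> (k n) * m (k n)) \<longlonglongrightarrow> V s (\<lambda>a s'. \<tau>l * r s a + wl s')"
      unfolding eq by (intro affinely_monotone_tendsto[OF V]) simp
  qed
  have osc_l: "1 - \<tau>l \<le> (\<Sum>s\<in>UNIV. \<Sum>s'\<in>UNIV. \<bar>wl s - wl s'\<bar>)"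
    using osc by (intro LIMSEQ_le[of "\<lambda>n. 1 - \<tau> (k n)" _
        "\<lambda>n. \<Sum>s\<in>UNIV. \<Sum>s'\<in>UNIV. \<bar>w (k n) s - w (k n) s'\<bar>"] tendsto_intros w_lim \<tau>_lim) blast
  \<comment> \<open>Otherwise the rewards vanish in the limit and the limit is a nonconstant fixed point.\<close>
  have "\<tau>l \<noteq> 0"
  proof
    assume "\<tau>l = 0"
    have "wl s = V s (\<lambda>a s'. wl s')" for s
      using eq_l[of s] unfolding \<open>\<tau>l = 0\<close> mult_zero_left add_0_left add_0_right .
    from const[OF this] have "\<bar>wl s - wl s'\<bar> = 0" for s s' by simp
    with osc_l \<open>\<tau>l = 0\<close> show False by simp
  qed
  with bounds have pos: "0 < \<tau>l" by simp
  have "wl s / \<tau>l = V s (\<lambda>a s'. r s a - ml + wl s' / \<tau>l)" for s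
  proof -
    have "V s (\<lambda>a s'. r s a - ml + wl s' / \<tau>l) = V s (\<lambda>a s'. (1 / \<tau>l) * (\<tau>l * r s a + wl s') + (- ml))"
      using pos by (intro arg_cong[where f = "V s"] ext) (simp add: field_simps)
    also have "\<dots> = (1 / \<tau>l) * (wl s + \<tau>l * ml) + (- ml)"
      using pos by (subst affinely_monotone_affine[OF V]) (simp_all add: eq_l)
    also have "\<dots> = wl s / \<tau>l" using pos by (simp add: field_simps)
    finally show ?thesis by simp
  qed
  moreover have "ml \<in> {0..1}" using bounds by simp
  ultimately show ?thesis
    by (intro exI[of _ "\<lambda>s. wl s / \<tau>l"] exI[of _ ml] conjI allI)
qed

section \<open>Finite-horizon laws\<close>

primrec prefix_law :: "('b list \<Rightarrow> 'b pmf) \<Rightarrow> nat \<Rightarrow> 'b list pmf" where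
  "prefix_law K 0 = return_pmf []"
| "prefix_law K (Suc n) = bind_pmf (prefix_law K n) (\<lambda>xs. map_pmf (\<lambda>x. xs @ [x]) (K xs))"

lemma length_prefix_law: "xs \<in> set_pmf (prefix_law K n) \<Longrightarrow> length xs = n"
  by (induction n arbitrary: xs) auto

lemma finite_prefix_law: "finite (set_pmf (prefix_law (K :: 'b::finite list \<Rightarrow> 'b pmf) n))"
  by (induction n) auto

lemma pmf_prefix_law:
  "pmf (prefix_law K (length xs)) xs = (\<Prod>i<length xs. pmf (K (take i xs)) (xs ! i))"
proof (induction xs rule: rev_induct)
  case Nil
  show ?case by simp
next
  case (snoc y ys)
  have last: "pmf (map_pmf (\<lambda>x. zs @ [x]) (K zs)) (ys @ [y]) = pmf (K ys) y * indicator {ys} zs" for zs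
  proof (cases "zs = ys")
    case True
    have "inj (\<lambda>x. ys @ [x])" by (simp add: inj_on_def)
    from pmf_map_inj'[OF this] True show ?thesis by simp
  next
    case False
    then have "ys @ [y] \<notin> set_pmf (map_pmf (\<lambda>x. zs @ [x]) (K zs))" by auto
    then have "pmf (map_pmf (\<lambda>x. zs @ [x]) (K zs)) (ys @ [y]) = 0"
      unfolding pmf_eq_0_set_pmf .
    then show ?thesis using False by simp
  qed
  have "pmf (prefix_law K (Suc (length ys))) (ys @ [y]) =
      measure_pmf.expectation (prefix_law K (length ys)) (\<lambda>zs. pmf (K ys) y * indicator {ys} zs)"
    by (simp only: prefix_law.simps pmf_bind last)
  also have "\<dots> = pmf (K ys) y * pmf (prefix_law K (length ys)) ys"
    by (simp add: measure_pmf_single)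
  also have "\<dots> = (\<Prod>i<Suc (length ys). pmf (K (take i (ys @ [y]))) ((ys @ [y]) ! i))"
    unfolding snoc.IH by (simp add: nth_append)
  finally show ?case by simp
qed

lemma sets_path_law:
  "sets (path_law (K :: 'b::finite list \<Rightarrow> 'b pmf)) = sets (PiM UNIV (\<lambda>_. count_space UNIV))"
proof -
  interpret IT: Ionescu_Tulcea "path_kernel K" "\<lambda>_. count_space UNIV"
    by (rule Ionescu_Tulcea_path_kernel)
  show ?thesis by (simp add: path_law_def)
qed

lemma space_path_law: "space (path_law (K :: 'b::finite list \<Rightarrow> 'b pmf)) = UNIV"
  using sets_eq_imp_space_eq[OF sets_path_law[of K]] by (simp add: space_PiM)

lemma prob_space_path_law: "prob_space (path_law (K :: 'b::finite list \<Rightarrow> 'b pmf))"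
proof
  have "measure (path_law K) UNIV = 1"
    using measure_path_law_cylinder[of K "[]"] by simp
  then show "emeasure (path_law K) (space (path_law K)) = 1"
    unfolding space_path_law measure_def by (cases "emeasure (path_law K) UNIV") auto
qed

lemma measurable_prefix:
  "(\<lambda>\<omega>. map \<omega> [0..<n]) \<in> measurable (path_law (K :: 'b::finite list \<Rightarrow> 'b pmf)) (count_space UNIV)"
proof -
  have "(\<lambda>\<omega>::nat \<Rightarrow> 'b. map \<omega> [0..<n]) \<in>
      measurable (PiM UNIV (\<lambda>_. count_space UNIV)) (count_space UNIV)"
  proof (induction n)
    case (Suc n)
    have "(\<lambda>\<omega>::nat \<Rightarrow> 'b. \<omega> n) \<in> measurable (PiM UNIV (\<lambda>_. count_space UNIV)) (count_space UNIV)"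
      by (rule measurable_component_singleton) simp
    then show ?case
      using measurable_compose_countable[OF _ Suc, of "\<lambda>xs \<omega>. xs @ [\<omega> n]" "count_space UNIV"]
      by simp
  qed simp
  then show ?thesis by (simp add: measurable_cong_sets[OF sets_path_law refl])
qed

text \<open>
  The cylinder probabilities of \<open>path_law K\<close> are the point masses of \<open>prefix_law K n\<close>. Hence all
  questions about the first \<open>n\<close> coordinates reduce to finite sums.
\<close>

lemma distr_path_law:
  fixes K :: "'b::finite list \<Rightarrow> 'b pmf"
  shows "distr (path_law K) (count_space UNIV) (\<lambda>\<omega>. map \<omega> [0..<n]) = measure_pmf (prefix_law K n)"
    (is "?D = _")
proof (rule measure_eqI_countable[of _ UNIV])
  interpret prob_space "path_law K" by (rule prob_space_path_law)
  show "emeasure ?D {xs} = emeasure (measure_pmf (prefix_law K n)) {xs}" for xs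
  proof (cases "length xs = n")
    case True
    have "(\<lambda>\<omega>. map \<omega> [0..<n]) -` {xs} = {\<omega>. \<forall>i<length xs. \<omega> i = xs ! i}"
    proof -
      have "map \<omega> [0..<n] = xs \<longleftrightarrow> (\<forall>i<length xs. \<omega> i = xs ! i)" for \<omega>
        using True by (metis (no_types) length_map length_upt diff_zero nth_equalityI nth_map_upt add_0)
      then show ?thesis by auto
    qed
    then have "emeasure ?D {xs} = emeasure (path_law K) {\<omega>. \<forall>i<length xs. \<omega> i = xs ! i}"
      by (simp add: emeasure_distr[OF measurable_prefix] space_path_law)
    also have "\<dots> = ennreal (pmf (prefix_law K n) xs)"
      using pmf_prefix_law[of K xs] measure_path_law_cylinder[of K xs] True
      by (simp add: emeasure_eq_measure)
    finally show ?thesis by (simp add: emeasure_pmf_single)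
  next
    case False
    then have "(\<lambda>\<omega>. map \<omega> [0..<n]) -` {xs} = {}" by auto
    moreover have "pmf (prefix_law K n) xs = 0"
      using False length_prefix_law[of xs K n] by (auto simp: set_pmf_iff)
    ultimately show ?thesis
      by (simp add: emeasure_distr[OF measurable_prefix] space_path_law emeasure_pmf_single)
  qed
qed auto

lemma integral_path_law_prefix:
  fixes K :: "'b::finite list \<Rightarrow> 'b pmf" and f :: "'b list \<Rightarrow> real"
  shows "(\<integral>\<omega>. f (map \<omega> [0..<n]) \<partial>path_law K) = measure_pmf.expectation (prefix_law K n) f"
  unfolding distr_path_law[symmetric]
  by (rule integral_distr[OF measurable_prefix, symmetric]) simp

lemma measure_path_law_prefix:
  fixes K :: "'b::finite list \<Rightarrow> 'b pmf"
  shows "measure (path_law K) {\<omega>. map \<omega> [0..<n] \<in> X} = measure (prefix_law K n) X"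
  unfolding distr_path_law[symmetric]
  by (subst measure_distr[OF measurable_prefix]) (auto simp: space_path_law vimage_def)

lemma expectation_prefix_law_Suc:
  fixes K :: "'b::finite list \<Rightarrow> 'b pmf" and f :: "'b list \<Rightarrow> real"
  shows "measure_pmf.expectation (prefix_law K (Suc n)) f =
    measure_pmf.expectation (prefix_law K n) (\<lambda>xs. \<Sum>x\<in>UNIV. pmf (K xs) x * f (xs @ [x]))"
proof -
  have "measure_pmf.expectation (prefix_law K (Suc n)) f =
      (\<Sum>xs\<in>set_pmf (prefix_law K n). pmf (prefix_law K n) xs *\<^sub>R
         measure_pmf.expectation (map_pmf (\<lambda>x. xs @ [x]) (K xs)) f)"
    unfolding prefix_law.simps by (rule pmf_expectation_bind) (auto simp: finite_prefix_law)
  also have "\<dots> = (\<Sum>xs\<in>set_pmf (prefix_law K n). pmf (prefix_law K n) xs *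
         (\<Sum>x\<in>UNIV. pmf (K xs) x * f (xs @ [x])))"
    by (auto intro!: sum.cong simp: integral_measure_pmf_real[of UNIV] mult.commute)
  also have "\<dots> = measure_pmf.expectation (prefix_law K n)
      (\<lambda>xs. \<Sum>x\<in>UNIV. pmf (K xs) x * f (xs @ [x]))"
    by (subst integral_measure_pmf[OF finite_prefix_law]) auto
  finally show ?thesis .
qed

lemma expectation_cong_pmf:
  fixes f :: "'b \<Rightarrow> real"
  assumes "\<And>x. x \<in> set_pmf p \<Longrightarrow> f x = g x"
  shows "measure_pmf.expectation p f = measure_pmf.expectation p g"
  by (rule integral_cong_AE) (simp_all add: AE_measure_pmf_iff assms)

section \<open>Recurrence in finite closed sets\<close>

text \<open>
  The probability that the chain started at \<open>x\<close> stays away from \<open>s\<close> at the times \<open>1, \<dots>, n\<close>,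
  computed by conditioning on the first step.
\<close>

primrec avoid :: "('s::finite \<Rightarrow> 's pmf) \<Rightarrow> 's \<Rightarrow> nat \<Rightarrow> 's \<Rightarrow> real" where
  "avoid T s 0 x = 1"
| "avoid T s (Suc n) x = (\<Sum>y\<in>UNIV. pmf (T x) y * (if y = s then 0 else avoid T s n y))"

lemma avoid_nonneg: "0 \<le> avoid T s n x"
  by (induction n arbitrary: x) (auto intro!: sum_nonneg)

lemma avoid_decreasing: "avoid T s (Suc n) x \<le> avoid T s n x"
proof (induction n arbitrary: x)
  case 0
  have "avoid T s (Suc 0) x \<le> (\<Sum>y\<in>UNIV. pmf (T x) y)"
    unfolding avoid.simps by (intro sum_mono) (auto)
  then show ?case by (simp add: sum_pmf_eq_1)
next
  case (Suc n)
  show ?case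
    unfolding avoid.simps(2)[of T s "Suc n"] avoid.simps(2)[of T s n]
    by (intro sum_mono mult_left_mono) (use Suc in auto)
qed

text \<open>
  The recursion of \<open>avoid\<close> removes the first step of a path, that of \<open>prefix_law\<close> the last one. The
  induction therefore runs over the intermediate claim that conditioning on the first \<open>n\<close> steps
  leaves \<open>k\<close> steps to be avoided.
\<close>

lemma avoid_eq_probability:
  fixes T :: "'s::finite \<Rightarrow> 's pmf" and s :: 's
  defines "K \<equiv> \<lambda>xs. if xs = [] then return_pmf s else T (last xs)"
  shows "measure (chain_law T s) {\<omega>. \<forall>i\<in>{1..n}. \<omega> i \<noteq> s} = avoid T s n s"
proof -
  have gen: "measure_pmf.expectation (prefix_law K (Suc n))
      (\<lambda>xs. if s \<in> set (tl xs) then 0 else avoid T s k (last xs)) = avoid T s (n + k) s" for k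
  proof (induction n arbitrary: k)
    case 0
    show ?case by (simp add: K_def bind_return_pmf)
  next
    case (Suc n)
    have step: "(\<Sum>x\<in>UNIV. pmf (K xs) x * (if s \<in> set (tl (xs @ [x])) then 0 else avoid T s k x)) =
        (if s \<in> set (tl xs) then 0 else avoid T s (Suc k) (last xs))"
      if "xs \<in> set_pmf (prefix_law K (Suc n))" for xs
    proof -
      have "xs \<noteq> []" using length_prefix_law[OF that] by auto
      then show ?thesis by (auto simp: K_def intro!: sum.cong)
    qed
    have "measure_pmf.expectation (prefix_law K (Suc (Suc n)))
        (\<lambda>xs. if s \<in> set (tl xs) then 0 else avoid T s k (last xs)) =
      measure_pmf.expectation (prefix_law K (Suc n)) (\<lambda>xs. \<Sum>x\<in>UNIV. pmf (K xs) x *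
        (if s \<in> set (tl (xs @ [x])) then 0 else avoid T s k x))"
      by (simp only: expectation_prefix_law_Suc last_snoc)
    also have "\<dots> = measure_pmf.expectation (prefix_law K (Suc n))
        (\<lambda>xs. if s \<in> set (tl xs) then 0 else avoid T s (Suc k) (last xs))"
      by (rule expectation_cong_pmf) (rule step)
    also have "\<dots> = avoid T s (n + Suc k) s" by (rule Suc.IH)
    finally show ?case by simp
  qed
  have "{\<omega>. \<forall>i\<in>{1..n}. \<omega> i \<noteq> s} = {\<omega>. map \<omega> [0..<Suc n] \<in> {xs. s \<notin> set (tl xs)}}"
  proof -
    have "tl (map \<omega> [0..<Suc n]) = map \<omega> [1..<Suc n]" for \<omega> :: "nat \<Rightarrow> 's"
      by (simp only: map_tl[symmetric] tl_upt) simp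
    moreover have "{1..<Suc n} = {1..n}" by auto
    ultimately show ?thesis by (auto simp del: upt_Suc)
  qed
  then have "measure (chain_law T s) {\<omega>. \<forall>i\<in>{1..n}. \<omega> i \<noteq> s} =
      measure (prefix_law K (Suc n)) {xs. s \<notin> set (tl xs)}"
    unfolding chain_law_def K_def by (simp only: measure_path_law_prefix)
  also have "\<dots> = measure_pmf.expectation (prefix_law K (Suc n)) (indicator {xs. s \<notin> set (tl xs)})"
    by simp
  also have "indicator {xs. s \<notin> set (tl xs)} =
      (\<lambda>xs. if s \<in> set (tl xs) then 0 else avoid T s 0 (last xs))"
    by (auto simp: indicator_def fun_eq_iff)
  finally show ?thesis using gen[of 0] by simp
qed

text \<open>
  In a minimal closed set \<open>B\<close> every state is recurrent. Let \<open>e x\<close> be the probability of never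
  visiting \<open>s \<in> B\<close> at a positive time. It is the average of its values at the successors other than
  \<open>s\<close>. If its maximum over \<open>B\<close> were positive, every successor of a maximizer would be a maximizer
  different from \<open>s\<close>. The maximizers other than \<open>s\<close> would then form a smaller closed set.
\<close>

lemma closed_set_has_recurrent_state:
  fixes T :: "'s::finite \<Rightarrow> 's pmf"
  assumes "M \<noteq> {}" "\<And>x. x \<in> M \<Longrightarrow> set_pmf (T x) \<subseteq> M"
  shows "\<exists>s\<in>M. \<not> transient T s"
proof -
  define closed_under where "closed_under A \<longleftrightarrow> A \<noteq> {} \<and> (\<forall>x\<in>A. set_pmf (T x) \<subseteq> A)" for A
  have "closed_under M" using assms by (auto simp: closed_under_def)
  then obtain B where B: "B \<subseteq> M" "closed_under B"
    and min: "\<And>A. A \<subseteq> M \<and> closed_under A \<Longrightarrow> A \<subseteq> B \<Longrightarrow> B = A"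
    using finite_has_minimal2[of "{A. A \<subseteq> M \<and> closed_under A}" M] by auto
  then obtain s where s: "s \<in> B" by (auto simp: closed_under_def)
  have "decseq (\<lambda>n. avoid T s n x)" for x
    by (rule decseq_SucI) (rule avoid_decreasing)
  then have "\<exists>l. (\<lambda>n. avoid T s n x) \<longlonglongrightarrow> l" for x
    using decseq_convergent[of "\<lambda>n. avoid T s n x" 0] avoid_nonneg by metis
  then obtain e where e: "\<And>x. (\<lambda>n. avoid T s n x) \<longlonglongrightarrow> e x"
    by metis
  have e_nonneg: "0 \<le> e x" for x
    by (rule LIMSEQ_le_const[OF e]) (auto simp: avoid_nonneg)
  have e_rec: "e x = (\<Sum>y\<in>UNIV. pmf (T x) y * (if y = s then 0 else e y))" for x
  proof (rule LIMSEQ_unique)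
    show "(\<lambda>n. avoid T s (Suc n) x) \<longlonglongrightarrow> e x" by (rule LIMSEQ_Suc) (rule e)
    show "(\<lambda>n. avoid T s (Suc n) x) \<longlonglongrightarrow> (\<Sum>y\<in>UNIV. pmf (T x) y * (if y = s then 0 else e y))"
      unfolding avoid.simps by (intro tendsto_sum tendsto_mult tendsto_const) (simp add: e)
  qed
  define m where "m = Max (e ` B)"
  have le_m: "e x \<le> m" if "x \<in> B" for x
    unfolding m_def using that by simp
  have "m = 0"
  proof (rule ccontr)
    assume "m \<noteq> 0"
    with le_m[OF s] e_nonneg[of s] have "m > 0" by simp
    define A where "A = {x\<in>B. e x = m} - {s}"
    have succ: "y \<in> A" if "x \<in> B" "e x = m" "y \<in> set_pmf (T x)" for x y
    proof -
      have yB: "y \<in> B" using that B by (auto simp: closed_under_def)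
      have "(\<Sum>z\<in>UNIV. pmf (T x) z * (m - (if z = s then 0 else e z))) =
          m * (\<Sum>z\<in>UNIV. pmf (T x) z) - (\<Sum>z\<in>UNIV. pmf (T x) z * (if z = s then 0 else e z))"
        unfolding sum_distrib_left sum_subtractf[symmetric]
        by (intro sum.cong) (auto simp: algebra_simps)
      also have "\<dots> = 0" using e_rec[of x] that by (simp add: sum_pmf_eq_1)
      finally have "(\<Sum>z\<in>UNIV. pmf (T x) z * (m - (if z = s then 0 else e z))) = 0" .
      moreover have "0 \<le> pmf (T x) z * (m - (if z = s then 0 else e z))" for z
      proof (cases "z \<in> set_pmf (T x)")
        case True
        then have "z \<in> B" using that B by (auto simp: closed_under_def)
        then show ?thesis using le_m \<open>m > 0\<close> by auto
      qed (simp add: set_pmf_iff)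
      ultimately have "pmf (T x) y * (m - (if y = s then 0 else e y)) = 0"
        by (subst (asm) sum_nonneg_eq_0_iff) auto
      moreover have "pmf (T x) y \<noteq> 0" using that by (simp add: set_pmf_iff)
      ultimately have "m = (if y = s then 0 else e y)" by simp
      with \<open>m > 0\<close> yB show ?thesis by (auto simp: A_def split: if_splits)
    qed
    have "m \<in> e ` B" unfolding m_def using s by (intro Max_in) auto
    then obtain x where "x \<in> B" "e x = m" by auto
    moreover obtain y where "y \<in> set_pmf (T x)" using set_pmf_not_empty[of "T x"] by blast
    ultimately have "A \<noteq> {}" using succ by blast
    moreover have "set_pmf (T x) \<subseteq> A" if "x \<in> A" for x
    proof -
      have "x \<in> B" "e x = m" using that by (auto simp: A_def)
      then show ?thesis using succ by blast
    qed
    ultimately have "closed_under A" by (auto simp: closed_under_def)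
    moreover have "A \<subseteq> B" by (auto simp: A_def)
    ultimately have "B = A" using min[of A] B by blast
    moreover have "s \<notin> A" unfolding A_def by blast
    ultimately show False using s by metis
  qed
  then have "e s = 0" using le_m[OF s] e_nonneg[of s] by simp
  interpret C: prob_space "chain_law T s"
    unfolding chain_law_def by (rule prob_space_path_law)
  have sets: "{\<omega>. P (\<omega> n)} \<in> C.events" for P :: "'s \<Rightarrow> bool" and n :: nat
  proof -
    have "(\<lambda>\<omega>::nat \<Rightarrow> 's. \<omega> n) \<in> measurable (PiM UNIV (\<lambda>_. count_space UNIV)) (count_space UNIV)"
      by (rule measurable_component_singleton) simp
    from measurable_sets[OF this, of "Collect P"]
    show ?thesis by (simp add: chain_law_def sets_path_law vimage_def space_PiM)
  qed
  have return_set: "{\<omega>. \<exists>n\<ge>1. \<omega> n = s} \<in> C.events"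
  proof -
    have "{\<omega>. \<exists>n\<ge>1. \<omega> n = s} = (\<Union>n\<in>{1..}. {\<omega>. \<omega> n = s})" by auto
    also have "\<dots> \<in> C.events" by (intro sets.countable_UN') (auto intro: sets)
    finally show ?thesis .
  qed
  have "1 - avoid T s n s \<le> measure (chain_law T s) {\<omega>. \<exists>n\<ge>1. \<omega> n = s}" for n
  proof -
    have space: "space (chain_law T s) = UNIV" by (simp add: chain_law_def space_path_law)
    have "{\<omega>. \<forall>i\<in>{1..n}. \<omega> i \<noteq> s} = (\<Inter>i\<in>{1..n}. {\<omega>. \<omega> i \<noteq> s}) \<inter> space (chain_law T s)" by (auto simp: space)
    also have "\<dots> \<in> C.events" 
      by (cases "n = 0") (auto intro!: sets.Int sets.finite_INT sets)
    finally have ev: "{\<omega>. \<forall>i\<in>{1..n}. \<omega> i \<noteq> s} \<in> C.events" .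
    have "1 - avoid T s n s = measure (chain_law T s) (space (chain_law T s) - {\<omega>. \<forall>i\<in>{1..n}. \<omega> i \<noteq> s})"
      by (simp only: C.prob_compl[OF ev] avoid_eq_probability)
    also have "\<dots> \<le> measure (chain_law T s) {\<omega>. \<exists>n\<ge>1. \<omega> n = s}"
      by (intro C.finite_measure_mono return_set) (auto simp: Suc_le_eq)
    finally show ?thesis .
  qed
  moreover have "(\<lambda>n. 1 - avoid T s n s) \<longlonglongrightarrow> 1 - e s" by (intro tendsto_intros e)
  ultimately have "1 \<le> measure (chain_law T s) {\<omega>. \<exists>n\<ge>1. \<omega> n = s}"
    using \<open>e s = 0\<close> LIMSEQ_le_const2[of "\<lambda>n. 1 - avoid T s n s" 1] by auto
  then have "\<not> transient T s" by (simp add: transient_def)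
  then show ?thesis using s B by blast
qed

section \<open>Communication excludes nonconstant solutions without reward\<close>

lemma matrix_power_closed_set:
  assumes "\<And>x. x \<in> M \<Longrightarrow> set_pmf (T x) \<subseteq> M" "s \<in> M" "s' \<notin> M"
  shows "matrix_power (transition_matrix T) N $ s $ s' = 0"
  using assms(2)
proof (induction N arbitrary: s)
  case 0
  then show ?case using assms(3) by (auto simp: mat_def)
next
  case (Suc N)
  have "pmf (T s) k * matrix_power (transition_matrix T) N $ k $ s' = 0" for k
  proof (cases "k \<in> M")
    case False
    then have "k \<notin> set_pmf (T s)" using assms(1)[OF Suc.prems] by blast
    then show ?thesis by (simp add: set_pmf_iff)
  qed (simp add: Suc.IH)
  then have "(\<Sum>k\<in>UNIV. pmf (T s) k * matrix_power (transition_matrix T) N $ k $ s') = 0"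
    by (intro sum.neutral ballI)
  moreover have "transition_matrix T $ s $ k = pmf (T s) k" for k
    by (simp add: transition_matrix_def)
  ultimately show ?case by (simp add: matrix_matrix_mult_def)
qed

text \<open>
  The maximum principle for a function that is subharmonic at \<open>s\<close>.
\<close>

lemma argmax_closed:
  fixes w :: "'s::finite \<Rightarrow> real"
  assumes le: "\<And>y. w y \<le> m" and "w s = m" and sub: "w s \<le> (\<Sum>y\<in>UNIV. pmf (T s) y * w y)"
    and y: "y \<in> set_pmf (T s)"
  shows "w y = m"
proof -
  have "(\<Sum>y\<in>UNIV. pmf (T s) y * (m - w y)) = m - (\<Sum>y\<in>UNIV. pmf (T s) y * w y)"
    by (simp add: right_diff_distrib sum_subtractf sum_distrib_right[symmetric] sum_pmf_eq_1)
  also have "\<dots> \<le> 0" using sub \<open>w s = m\<close> by simp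
  finally have "(\<Sum>y\<in>UNIV. pmf (T s) y * (m - w y)) \<le> 0" .
  moreover have nonneg: "0 \<le> pmf (T s) y * (m - w y)" for y using le[of y] by simp
  ultimately have "(\<Sum>y\<in>UNIV. pmf (T s) y * (m - w y)) = 0"
    by (intro antisym sum_nonneg) auto
  then have "pmf (T s) y * (m - w y) = 0"
    using nonneg by (subst (asm) sum_nonneg_eq_0_iff) auto
  then show ?thesis using y by (simp add: set_pmf_iff)
qed

text \<open>
  Both closed sets that occur contain a recurrent state and so meet \<open>C\<close>. The maximizers of \<open>w\<close> are
  closed under every chain of the family. They are therefore never left, and by communication they
  contain \<open>C\<close>. The minimizers are closed under the chain \<open>R\<close>, for which \<open>w\<close> is harmonic. Hence a state
  of \<open>C\<close> is both a maximizer and a minimizer.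
\<close>

lemma communicating_chains_constant:
  fixes Ts :: "('s::finite \<Rightarrow> 's pmf) set" and w :: "'s \<Rightarrow> real"
  assumes comm: "\<And>s s'. s \<in> C \<Longrightarrow> s' \<in> C \<Longrightarrow>
      \<exists>T\<in>Ts. \<exists>N\<ge>1. matrix_power (transition_matrix T) N $ s $ s' > 0"
    and trans: "\<And>s T. s \<notin> C \<Longrightarrow> T \<in> Ts \<Longrightarrow> transient T s"
    and sub: "\<And>T s. T \<in> Ts \<Longrightarrow> w s \<le> (\<Sum>y\<in>UNIV. pmf (T s) y * w y)"
    and R: "R \<in> Ts" "\<And>s. (\<Sum>y\<in>UNIV. pmf (R s) y * w y) \<le> w s"
  shows "w s = w s'"
proof -
  define hi where "hi = Max (range w)"
  define lo where "lo = Min (range w)"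
  have le_hi: "w y \<le> hi" and ge_lo: "lo \<le> w y" for y by (simp_all add: hi_def lo_def)
  have "hi \<in> range w" "lo \<in> range w" by (auto simp: hi_def lo_def intro: Max_in Min_in)
  then have ne: "{y. w y = hi} \<noteq> {}" "{y. w y = lo} \<noteq> {}" by auto
  have hi_closed: "set_pmf (T y) \<subseteq> {y. w y = hi}" if "T \<in> Ts" "y \<in> {y. w y = hi}" for T y
    using argmax_closed[where w = w and s = y and T = T, OF le_hi] sub[OF that(1), of y] that by blast
  have lo_closed: "set_pmf (R y) \<subseteq> {y. w y = lo}" if "y \<in> {y. w y = lo}" for y
    using argmax_closed[where w = "\<lambda>y. - w y" and m = "- lo" and s = y and T = R] ge_lo R(2)[of y] that
    by (auto simp: sum_negf)
  obtain y where y: "w y = hi" "y \<in> C"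
    using closed_set_has_recurrent_state[OF ne(1), of R] hi_closed R(1) trans by blast
  obtain z where z: "w z = lo" "z \<in> C"
    using closed_set_has_recurrent_state[OF ne(2), of R] lo_closed R(1) trans by blast
  obtain T N where T: "T \<in> Ts" "matrix_power (transition_matrix T) N $ y $ z > 0"
    using comm[OF y(2) z(2)] by blast
  have "w z = hi"
    using matrix_power_closed_set[of "{y. w y = hi}" T y z N] hi_closed[OF T(1)] T(2) y(1) by force
  with z have "hi = lo" by simp
  then show ?thesis using le_hi[of s] le_hi[of s'] ge_lo[of s] ge_lo[of s'] by simp
qed

lemma expectation_induced_chain:
  "(\<Sum>y\<in>UNIV. pmf (induced_chain p \<Delta> s) y * w y) = payoff (\<lambda>a s'. w s') (\<Delta> s) (p s)"
  unfolding pmf_induced_chain payoff_def sum_distrib_right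
  by (subst sum.swap) (simp add: mult.commute)

text \<open>
  Fix a rule \<open>\<Delta>\<close> that attains the outer supremum in every state. Then \<open>w\<close> is subharmonic for the chains of all
  kernels and harmonic for that of a best reply, and weak communication of \<open>\<Delta>\<close> applies.
\<close>

lemma SUP_INF_fixed_point_constant:
  fixes Q :: "'a::finite pmf set" and P :: "'s::finite \<Rightarrow> ('a \<Rightarrow> 's pmf) set"
  assumes P: "\<And>s. P s \<noteq> {}" and Q: "Q \<noteq> {}"
    and wc: "weakly_communicating_controller Q P"
    and cQ: "compact (pmf_vec ` Q)" and cP: "\<And>s. compact (kernel_vec ` P s)"
    and fixed: "\<And>s. w s = (SUP \<phi>\<in>Q. INF q\<in>P s. payoff (\<lambda>a s'. w s') \<phi> q)"
  shows "w s = w s'"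
proof -
  have "\<exists>\<phi>\<in>Q. \<forall>q\<in>P s. w s \<le> payoff (\<lambda>a s'. w s') \<phi> q" for s
    using SUP_INF_payoff_attained[where f = "\<lambda>a. w", OF cQ Q P[of s]] fixed[of s] by metis
  then obtain \<Delta> where \<Delta>: "\<And>s. \<Delta> s \<in> Q" "\<And>s q. q \<in> P s \<Longrightarrow> w s \<le> payoff (\<lambda>a s'. w s') (\<Delta> s) q"
    by metis
  have "\<exists>q\<in>P s. payoff (\<lambda>a s'. w s') (\<Delta> s) q \<le> w s" for s
    using payoff_best_reply_adversary[where f = "\<lambda>a. w", OF cP[of s] P[of s] \<Delta>(1)[of s]] fixed[of s] by metis
  then obtain p0 where p0: "\<And>s. p0 s \<in> P s" "\<And>s. payoff (\<lambda>a s'. w s') (\<Delta> s) (p0 s) \<le> w s"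
    by metis
  from wc \<Delta>(1) have "weakly_communicating_rule P \<Delta>"
    by (simp add: weakly_communicating_controller_def stationary_rules_def)
  then obtain C where "(\<forall>s\<in>C. \<forall>s'\<in>C. \<exists>p\<in>rectangular P. \<exists>N\<ge>1.
        matrix_power (transition_matrix (induced_chain p \<Delta>)) N $ s $ s' > 0) \<and>
      (\<forall>s. s \<notin> C \<longrightarrow> (\<forall>p\<in>rectangular P. transient (induced_chain p \<Delta>) s))"
    unfolding weakly_communicating_rule_def by (rule exE)
  note C = this[THEN conjunct1, rule_format] this[THEN conjunct2, rule_format]
  show ?thesis
  proof (rule communicating_chains_constant[where C = C and R = "induced_chain p0 \<Delta>"
        and Ts = "(\<lambda>p. induced_chain p \<Delta>) ` rectangular P"])
    show "\<exists>T\<in>(\<lambda>p. induced_chain p \<Delta>) ` rectangular P.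
        \<exists>N\<ge>1. 0 < matrix_power (transition_matrix T) N $ s $ s'" if "s \<in> C" "s' \<in> C" for s s'
      using C(1)[OF that] by (elim bexE, intro bexI[OF _ imageI])
    show "transient T s" if "s \<notin> C" "T \<in> (\<lambda>p. induced_chain p \<Delta>) ` rectangular P" for s T
      using C(2)[OF that(1)] that(2) by blast
    show "w s \<le> (\<Sum>y\<in>UNIV. pmf (T s) y * w y)"
      if mem: "T \<in> (\<lambda>p. induced_chain p \<Delta>) ` rectangular P" for s T
    proof -
      obtain p where "T = induced_chain p \<Delta>" "p s \<in> P s"
        using mem by (auto simp: rectangular_def)
      then show ?thesis using \<Delta>(2) by (simp only: expectation_induced_chain)
    qed
    show "induced_chain p0 \<Delta> \<in> (\<lambda>p. induced_chain p \<Delta>) ` rectangular P"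
      using p0(1) by (intro imageI) (simp add: rectangular_def)
    show "(\<Sum>y\<in>UNIV. pmf (induced_chain p0 \<Delta> s) y * w y) \<le> w s" for s
      unfolding expectation_induced_chain by (rule p0(2))
  qed
qed

text \<open>
  The mirror image: for a kernel that attains the outer infimum, \<open>- w\<close> is subharmonic under all rules
  and harmonic under a best reply.
\<close>

lemma INF_SUP_fixed_point_constant:
  fixes Q :: "'a::finite pmf set" and P :: "'s::finite \<Rightarrow> ('a \<Rightarrow> 's pmf) set"
  assumes P: "\<And>s. P s \<noteq> {}" and Q: "Q \<noteq> {}"
    and wc: "weakly_communicating_adversary Q P"
    and cQ: "compact (pmf_vec ` Q)" and cP: "\<And>s. compact (kernel_vec ` P s)"
    and fixed: "\<And>s. w s = (INF q\<in>P s. SUP \<phi>\<in>Q. payoff (\<lambda>a s'. w s') \<phi> q)"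
  shows "w s = w s'"
proof -
  have "\<exists>q\<in>P s. \<forall>\<phi>\<in>Q. payoff (\<lambda>a s'. w s') \<phi> q \<le> w s" for s
    using INF_SUP_payoff_attained[where f = "\<lambda>a. w", OF cP[of s] Q P[of s]] fixed[of s] by metis
  then obtain p where p: "\<And>s. p s \<in> P s" "\<And>s \<phi>. \<phi> \<in> Q \<Longrightarrow> payoff (\<lambda>a s'. w s') \<phi> (p s) \<le> w s"
    by metis
  have "\<exists>\<phi>\<in>Q. w s \<le> payoff (\<lambda>a s'. w s') \<phi> (p s)" for s
    using payoff_best_reply_controller[where f = "\<lambda>a. w", OF cQ Q p(1)[of s]] fixed[of s] by metis
  then obtain \<Delta>0 where \<Delta>0: "\<And>s. \<Delta>0 s \<in> Q" "\<And>s. w s \<le> payoff (\<lambda>a s'. w s') (\<Delta>0 s) (p s)"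
    by metis
  from wc p(1) have "weakly_communicating_kernel Q p"
    by (simp add: weakly_communicating_adversary_def rectangular_def)
  then obtain C where "(\<forall>s\<in>C. \<forall>s'\<in>C. \<exists>\<Delta>\<in>stationary_rules Q. \<exists>N\<ge>1.
        matrix_power (transition_matrix (induced_chain p \<Delta>)) N $ s $ s' > 0) \<and>
      (\<forall>s. s \<notin> C \<longrightarrow> (\<forall>\<Delta>\<in>stationary_rules Q. transient (induced_chain p \<Delta>) s))"
    unfolding weakly_communicating_kernel_def by (rule exE)
  note C = this[THEN conjunct1, rule_format] this[THEN conjunct2, rule_format]
  have "- w s = - w s'"
  proof (rule communicating_chains_constant[where C = C and R = "induced_chain p \<Delta>0"
        and Ts = "(\<lambda>\<Delta>. induced_chain p \<Delta>) ` stationary_rules Q" and w = "\<lambda>s. - w s"])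
    show "\<exists>T\<in>(\<lambda>\<Delta>. induced_chain p \<Delta>) ` stationary_rules Q.
        \<exists>N\<ge>1. 0 < matrix_power (transition_matrix T) N $ s $ s'" if "s \<in> C" "s' \<in> C" for s s'
      using C(1)[OF that] by (elim bexE, intro bexI[OF _ imageI])
    show "transient T s" if "s \<notin> C" "T \<in> (\<lambda>\<Delta>. induced_chain p \<Delta>) ` stationary_rules Q" for s T
      using C(2)[OF that(1)] that(2) by blast
    show "- w s \<le> (\<Sum>y\<in>UNIV. pmf (T s) y * - w y)"
      if mem: "T \<in> (\<lambda>\<Delta>. induced_chain p \<Delta>) ` stationary_rules Q" for s T
    proof -
      obtain \<Delta> where T: "T = induced_chain p \<Delta>" and "\<Delta> s \<in> Q"
        using mem by (auto simp: stationary_rules_def)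
      show ?thesis
        unfolding T expectation_induced_chain payoff_uminus using p(2)[OF \<open>\<Delta> s \<in> Q\<close>] by simp
    qed
    show "induced_chain p \<Delta>0 \<in> (\<lambda>\<Delta>. induced_chain p \<Delta>) ` stationary_rules Q"
      using \<Delta>0(1) by (intro imageI) (simp add: stationary_rules_def)
    show "(\<Sum>y\<in>UNIV. pmf (induced_chain p \<Delta>0 s) y * - w y) \<le> - w s" for s
      unfolding expectation_induced_chain payoff_uminus using \<Delta>0(2)[of s] by simp
  qed
  then show ?thesis by simp
qed

theorem sup_inf_solution_exists:
  fixes Q :: "'a::finite pmf set" and P :: "'s::finite \<Rightarrow> ('a \<Rightarrow> 's pmf) set"
  assumes r: "\<And>s a. 0 \<le> r s a \<and> r s a \<le> 1"
    and P: "\<And>s. P s \<noteq> {}" and Q: "Q \<noteq> {}"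
    and wc: "weakly_communicating_controller Q P"
    and cQ: "compact (pmf_vec ` Q)" and cP: "\<And>s. compact (kernel_vec ` P s)"
  shows "\<exists>u \<alpha>. sup_inf_solution r Q P u \<alpha>"
  unfolding sup_inf_solution_def bellman_term_eq_payoff
  by (rule ergodic_equation_solvable[where V = "\<lambda>s f. SUP \<phi>\<in>Q. INF q\<in>P s. payoff f \<phi> q",
        OF affinely_monotone_SUP_INF_payoff[OF Q P] r SUP_INF_fixed_point_constant[OF P Q wc cQ cP]])

theorem inf_sup_solution_exists:
  fixes Q :: "'a::finite pmf set" and P :: "'s::finite \<Rightarrow> ('a \<Rightarrow> 's pmf) set"
  assumes r: "\<And>s a. 0 \<le> r s a \<and> r s a \<le> 1"
    and P: "\<And>s. P s \<noteq> {}" and Q: "Q \<noteq> {}"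
    and wc: "weakly_communicating_adversary Q P"
    and cQ: "compact (pmf_vec ` Q)" and cP: "\<And>s. compact (kernel_vec ` P s)"
  shows "\<exists>u \<alpha>. inf_sup_solution r Q P u \<alpha>"
  unfolding inf_sup_solution_def bellman_term_eq_payoff
  by (rule ergodic_equation_solvable[where V = "\<lambda>s f. INF q\<in>P s. SUP \<phi>\<in>Q. payoff f \<phi> q",
        OF affinely_monotone_INF_SUP_payoff[OF Q P] r INF_SUP_fixed_point_constant[OF P Q wc cQ cP]])

section \<open>Laws of histories under a stationary adversary\<close>

primrec history_law ::
  "'s pmf \<Rightarrow> ('s, 'a) policy \<Rightarrow> ('s \<Rightarrow> 'a \<Rightarrow> 's pmf) \<Rightarrow> nat \<Rightarrow> ('s, 'a) history pmf" where
  "history_law \<mu> \<pi> p 0 = map_pmf (Pair []) \<mu>"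
| "history_law \<mu> \<pi> p (Suc n) =
     bind_pmf (history_law \<mu> \<pi> p n) (\<lambda>h. bind_pmf (\<pi> h) (\<lambda>a.
       map_pmf (Pair (fst h @ [(snd h, a)])) (p (snd h) a)))"

lemma finite_history_law:
  "finite (set_pmf (history_law (\<mu> :: 's::finite pmf) (\<pi> :: ('s, 'a::finite) policy) p n))"
  by (induction n) auto

text \<open>
  The coordinates of the path law are state-action pairs, so that a prefix ends with an action,
  whereas a history ends with a state. The law of histories is obtained from that of prefixes by
  drawing one more state.
\<close>

lemma history_law_eq_prefix_law:
  "history_law \<mu> \<pi> p n = bind_pmf (prefix_law (step_kernel \<mu> \<pi> (\<lambda>h. p (snd h))) n)
     (\<lambda>xs. map_pmf (Pair xs) (if xs = [] then \<mu> else p (fst (last xs)) (snd (last xs))))"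
proof (induction n)
  case 0
  show ?case by (simp add: bind_return_pmf)
next
  case (Suc n)
  define K where "K = step_kernel \<mu> \<pi> (\<lambda>h. p (snd h))"
  have K: "bind_pmf (K xs) f = bind_pmf (if xs = [] then \<mu> else p (fst (last xs)) (snd (last xs)))
      (\<lambda>x. bind_pmf (\<pi> (xs, x)) (\<lambda>a. f (x, a)))" for xs and f :: "_ \<Rightarrow> ('a, 'b) history pmf"
    by (simp add: K_def step_kernel_def bind_assoc_pmf bind_map_pmf)
  show ?case
    unfolding history_law.simps Suc K_def[symmetric]
    by (simp add: bind_assoc_pmf bind_map_pmf K map_bind_pmf map_pmf_comp)
qed

lemma map_fst_history_law:
  "map_pmf fst (history_law \<mu> \<pi> p n) = prefix_law (step_kernel \<mu> \<pi> (\<lambda>h. p (snd h))) n"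
  by (simp add: history_law_eq_prefix_law map_bind_pmf map_pmf_comp bind_return_pmf' map_pmf_const)

definition total_reward :: "('s \<Rightarrow> 'a \<Rightarrow> real) \<Rightarrow> ('s, 'a) history \<Rightarrow> real" where
  "total_reward r h = (\<Sum>(s, a)\<leftarrow>fst h. r s a)"

lemma total_reward_Nil: "total_reward r ([], x) = 0"
  and total_reward_snoc: "total_reward r (xs @ [(x, a)], x') = total_reward r (xs, x) + r x a"
  by (simp_all add: total_reward_def)

abbreviation history_expectation ::
  "'s pmf \<Rightarrow> ('s, 'a) policy \<Rightarrow> ('s \<Rightarrow> 'a \<Rightarrow> 's pmf) \<Rightarrow> nat \<Rightarrow> (('s, 'a) history \<Rightarrow> real) \<Rightarrow> real"
  where "history_expectation \<mu> \<pi> p n \<equiv> measure_pmf.expectation (history_law \<mu> \<pi> p n)"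

lemma mean_reward_eq:
  fixes r :: "'s::finite \<Rightarrow> 'a::finite \<Rightarrow> real"
  shows "mean_reward r \<mu> \<pi> (\<lambda>h. p (snd h)) n =
    history_expectation \<mu> \<pi> p n (total_reward r) / real n"
proof -
  let ?K = "step_kernel \<mu> \<pi> (\<lambda>h. p (snd h))"
  have "(\<Sum>k<n. r (fst (\<omega> k)) (snd (\<omega> k))) = (\<Sum>(s, a)\<leftarrow>map \<omega> [0..<n]. r s a)" for \<omega>
    by (induction n) (auto simp: case_prod_unfold)
  then have "mean_reward r \<mu> \<pi> (\<lambda>h. p (snd h)) n =
      measure_pmf.expectation (prefix_law ?K n) (\<lambda>xs. (1 / real n) * (\<Sum>(s, a)\<leftarrow>xs. r s a))"
    unfolding mean_reward_def by (simp only: integral_path_law_prefix[symmetric])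
  also have "\<dots> = history_expectation \<mu> \<pi> p n (\<lambda>h. (1 / real n) * total_reward r h)"
    unfolding map_fst_history_law[symmetric] by (simp add: total_reward_def)
  also have "\<dots> = history_expectation \<mu> \<pi> p n (total_reward r) / real n"
    by (simp only: integral_mult_right_zero) simp
  finally show ?thesis .
qed

lemma integrable_history_law:
  "integrable (history_law (\<mu> :: 's::finite pmf) (\<pi> :: ('s, 'a::finite) policy) p n) (f :: _ \<Rightarrow> real)"
  by (rule integrable_measure_pmf_finite[OF finite_history_law])

lemma expectation_history_law_Suc:
  fixes \<mu> :: "'s::finite pmf" and \<pi> :: "('s, 'a::finite) policy"
  shows "history_expectation \<mu> \<pi> p (Suc n) f = history_expectation \<mu> \<pi> p n
    (\<lambda>h. payoff (\<lambda>a x'. f (fst h @ [(snd h, a)], x')) (\<pi> h) (p (snd h)))"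
proof -
  have inner: "measure_pmf.expectation (bind_pmf (\<pi> h) (\<lambda>a. map_pmf (Pair (fst h @ [(snd h, a)])) (p (snd h) a))) f
      = payoff (\<lambda>a x'. f (fst h @ [(snd h, a)], x')) (\<pi> h) (p (snd h))" for h
    by (subst pmf_expectation_bind[where A = UNIV])
      (auto simp: payoff_nested integral_measure_pmf_real[of UNIV] mult.commute intro!: sum.cong)
  show ?thesis
    unfolding history_law.simps
    by (subst pmf_expectation_bind[OF finite_history_law])
      (auto simp: inner integral_measure_pmf[OF finite_history_law])
qed

text \<open>
  The form in which submartingale arguments enter: the conditional one-step increment of \<open>f\<close> is at
  least \<open>c\<close>.
\<close>

lemma expectation_drift_ge:
  fixes \<mu> :: "'s::finite pmf" and \<pi> :: "('s, 'a::finite) policy"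
  assumes "\<And>xs x. f (xs, x) + c \<le> payoff (\<lambda>a x'. f (xs @ [(x, a)], x')) (\<pi> (xs, x)) (p x)"
  shows "history_expectation \<mu> \<pi> p 0 f + real n * c \<le> history_expectation \<mu> \<pi> p n f"
proof (induction n)
  case (Suc n)
  have "history_expectation \<mu> \<pi> p n f + c = history_expectation \<mu> \<pi> p n (\<lambda>h. f h + c)"
    by (simp add: integrable_history_law)
  also have "\<dots> \<le> history_expectation \<mu> \<pi> p (Suc n) f"
    unfolding expectation_history_law_Suc
    by (intro integral_mono integrable_history_law) (use assms in auto)
  finally show ?case using Suc by (simp add: algebra_simps)
qed simp

lemma expectation_drift_le:
  fixes \<mu> :: "'s::finite pmf" and \<pi> :: "('s, 'a::finite) policy"
  assumes "\<And>xs x. payoff (\<lambda>a x'. f (xs @ [(x, a)], x')) (\<pi> (xs, x)) (p x) \<le> f (xs, x) + c"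
  shows "history_expectation \<mu> \<pi> p n f \<le> history_expectation \<mu> \<pi> p 0 f + real n * c"
proof -
  have "history_expectation \<mu> \<pi> p 0 (\<lambda>h. - f h) + real n * (- c) \<le> history_expectation \<mu> \<pi> p n (\<lambda>h. - f h)"
  proof (rule expectation_drift_ge)
    show "- f (xs, x) + - c \<le> payoff (\<lambda>a x'. - f (xs @ [(x, a)], x')) (\<pi> (xs, x)) (p x)" for xs x
      using assms[of xs x] unfolding payoff_uminus by simp
  qed
  then show ?thesis by simp
qed

lemma finite_function_bounded: "\<exists>B\<ge>0. \<forall>s. \<bar>u s :: real\<bar> \<le> B" for u :: "'s::finite \<Rightarrow> real"
  by (intro exI[of _ "\<Sum>s\<in>UNIV. \<bar>u s\<bar>"]) (auto intro: member_le_sum sum_nonneg)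

lemma expectation_history_law_mono:
  fixes \<mu> :: "'s::finite pmf" and \<pi> :: "('s, 'a::finite) policy"
  assumes "\<And>h. h \<in> set_pmf (history_law \<mu> \<pi> p n) \<Longrightarrow> f h \<le> g h"
  shows "history_expectation \<mu> \<pi> p n f \<le> history_expectation \<mu> \<pi> p n g"
  by (rule integral_mono_AE[OF integrable_history_law integrable_history_law])
    (simp add: AE_measure_pmf_iff assms)

text \<open>
  The drift of the total reward plus \<open>u\<close> of the current state is at least \<open>\<alpha>\<close>, and \<open>u\<close> is bounded.
\<close>

lemma expected_reward_ge:
  fixes r :: "'s::finite \<Rightarrow> 'a::finite \<Rightarrow> real"
  assumes le: "\<And>xs x. u x \<le> bellman_term r u \<alpha> x (\<pi> (xs, x)) (p x)"
  shows "\<exists>B\<ge>0. \<forall>n. real n * \<alpha> - B \<le> history_expectation \<mu> \<pi> p n (total_reward r)"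
proof -
  obtain B where B: "B \<ge> 0" "\<And>s. \<bar>u s\<bar> \<le> B" using finite_function_bounded[of u] by metis
  define f where "f h = total_reward r h + u (snd h)" for h :: "('s, 'a) history"
  have "real n * \<alpha> - 2 * B \<le> history_expectation \<mu> \<pi> p n (total_reward r)" for n
  proof -
    have "history_expectation \<mu> \<pi> p 0 f + real n * \<alpha> \<le> history_expectation \<mu> \<pi> p n f"
    proof (rule expectation_drift_ge)
      fix xs x
      have "payoff (\<lambda>a x'. f (xs @ [(x, a)], x')) (\<pi> (xs, x)) (p x) =
          payoff (\<lambda>a x'. 1 * (r x a - \<alpha> + u x') + (total_reward r (xs, x) + \<alpha>)) (\<pi> (xs, x)) (p x)"
        by (simp add: f_def total_reward_snoc[where x = x] algebra_simps)
      also have "\<dots> = bellman_term r u \<alpha> x (\<pi> (xs, x)) (p x) + (total_reward r (xs, x) + \<alpha>)"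
        by (subst payoff_affine) (simp add: bellman_term_eq_payoff)
      finally show "f (xs, x) + \<alpha> \<le> payoff (\<lambda>a x'. f (xs @ [(x, a)], x')) (\<pi> (xs, x)) (p x)"
        using le[of x xs] by (simp add: f_def)
    qed
    moreover have "- B \<le> history_expectation \<mu> \<pi> p 0 f"
    proof -
      have "history_expectation \<mu> \<pi> p 0 (\<lambda>_. - B) \<le> history_expectation \<mu> \<pi> p 0 f"
        using B(2) by (intro expectation_history_law_mono)
          (auto simp: f_def total_reward_Nil abs_le_iff minus_le_iff)
      then show ?thesis by simp
    qed
    moreover have "history_expectation \<mu> \<pi> p n f \<le> history_expectation \<mu> \<pi> p n (total_reward r) + B"
    proof -
      have "history_expectation \<mu> \<pi> p n f \<le> history_expectation \<mu> \<pi> p n (\<lambda>h. total_reward r h + B)"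
        using B(2) by (intro expectation_history_law_mono) (auto simp: f_def abs_le_iff)
      then show ?thesis by (simp add: integrable_history_law)
    qed
    ultimately show ?thesis by linarith
  qed
  then show ?thesis using B(1) by (intro exI[of _ "2 * B"]) auto
qed

text \<open>
  The previous lemma for \<open>- r\<close>, \<open>- u\<close> and \<open>- \<alpha>\<close>.
\<close>

lemma expected_reward_le:
  fixes r :: "'s::finite \<Rightarrow> 'a::finite \<Rightarrow> real"
  assumes le: "\<And>xs x. bellman_term r u \<alpha> x (\<pi> (xs, x)) (p x) \<le> u x"
  shows "\<exists>B\<ge>0. \<forall>n. history_expectation \<mu> \<pi> p n (total_reward r) \<le> real n * \<alpha> + B"
proof -
  have bellman: "bellman_term (\<lambda>s a. - r s a) (\<lambda>s. - u s) (- \<alpha>) s \<phi> q = - bellman_term r u \<alpha> s \<phi> q" for s \<phi> q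
    unfolding bellman_term_eq_payoff payoff_uminus[symmetric] by (simp add: algebra_simps)
  have total: "total_reward (\<lambda>s a. - r s a) = (\<lambda>h. - total_reward r h)"
  proof
    fix h :: "('s, 'a) history"
    show "total_reward (\<lambda>s a. - r s a) h = - total_reward r h"
      unfolding total_reward_def by (induction "fst h" arbitrary: h) (auto simp: total_reward_def uminus_sum_list_map o_def case_prod_unfold)
  qed
  have "\<exists>B\<ge>0. \<forall>n. real n * (- \<alpha>) - B \<le> history_expectation \<mu> \<pi> p n (total_reward (\<lambda>s a. - r s a))"
    by (rule expected_reward_ge[where u = "\<lambda>s. - u s"]) (simp add: bellman le)
  then obtain B where B: "B \<ge> 0" "\<And>n. real n * (- \<alpha>) - B \<le> - history_expectation \<mu> \<pi> p n (total_reward r)"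
    unfolding total by auto
  have "history_expectation \<mu> \<pi> p n (total_reward r) \<le> real n * \<alpha> + B" for n
    using B(2)[of n] by simp
  with B(1) show ?thesis by blast
qed

section \<open>A greedy policy that learns the adversary's kernel\<close>

definition transitions :: "('s, 'a) history \<Rightarrow> ('s \<times> 'a \<times> 's) list" where
  "transitions h = map (\<lambda>((s, a), s'). (s, a, s')) (zip (fst h) (tl (map fst (fst h) @ [snd h])))"

lemma transitions_Nil: "transitions ([], x) = []"
  by (simp add: transitions_def)

lemma transitions_snoc: "transitions (xs @ [(x, a)], x') = transitions (xs, x) @ [(x, a, x')]"
proof -
  have "tl (map fst (xs @ [(x, a)]) @ [x']) = tl (map fst xs @ [x]) @ [x']"
    by (cases xs) auto
  moreover have "length xs = length (tl (map fst xs @ [x]))" by simp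
  ultimately show ?thesis by (simp add: transitions_def)
qed

text \<open>
  The accumulated gain \<open>g s a x'\<close> over the past transitions that left \<open>s\<close> with action \<open>a\<close>.
\<close>

definition score :: "('s \<Rightarrow> 'a \<Rightarrow> 's \<Rightarrow> real) \<Rightarrow> ('s, 'a) history \<Rightarrow> 's \<Rightarrow> 'a \<Rightarrow> real" where
  "score g h s a = (\<Sum>(y, b, x')\<leftarrow>transitions h. if y = s \<and> b = a then g s a x' else 0)"

lemma score_Nil: "score g ([], x) s a = 0"
  and score_snoc: "score g (xs @ [(x, b)], x') s a =
    score g (xs, x) s a + (if x = s \<and> b = a then g s a x' else 0)"
  by (simp_all add: score_def transitions_Nil transitions_snoc)

text \<open>
  Lindley's recursion for the score: the random walk \<open>score g h s a\<close> reflected at \<open>0\<close>, which is its excess over its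
  running minimum (including the starting value \<open>0\<close>). For a centered walk, bounding the expectation of the
  reflected walk bounds that of the running minimum without a maximal inequality.
\<close>

definition reflected_score :: "('s \<Rightarrow> 'a \<Rightarrow> 's \<Rightarrow> real) \<Rightarrow> ('s, 'a) history \<Rightarrow> 's \<Rightarrow> 'a \<Rightarrow> real" where
  "reflected_score g h s a =
     foldl (\<lambda>R (y, b, x'). max 0 (R + (if y = s \<and> b = a then g s a x' else 0))) 0 (transitions h)"

lemma reflected_score_Nil: "reflected_score g ([], x) s a = 0"
  and reflected_score_snoc: "reflected_score g (xs @ [(x, b)], x') s a =
    max 0 (reflected_score g (xs, x) s a + (if x = s \<and> b = a then g s a x' else 0))"
  by (simp_all add: reflected_score_def transitions_Nil transitions_snoc)

lemma reflected_score_nonneg: "0 \<le> reflected_score g (xs, x) s a"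
proof (induction xs arbitrary: x rule: rev_induct)
  case (snoc z zs)
  then show ?case by (cases z) (simp add: reflected_score_snoc)
qed (simp add: reflected_score_Nil)

text \<open>
  In every state, play an action whose past transitions from that state have the largest total gain.
\<close>

definition greedy_policy :: "('s \<Rightarrow> 'a \<Rightarrow> 's \<Rightarrow> real) \<Rightarrow> ('s, 'a) policy" where
  "greedy_policy g h = return_pmf (SOME a. \<forall>b. score g h (snd h) b \<le> score g h (snd h) a)"

lemma greedy_policy_maximizes:
  fixes g :: "'s \<Rightarrow> 'a::finite \<Rightarrow> 's \<Rightarrow> real"
  assumes "a \<in> set_pmf (greedy_policy g h)"
  shows "score g h (snd h) b \<le> score g h (snd h) a"
proof -
  let ?v = "score g h (snd h)"
  have "Max (range ?v) \<in> range ?v" by (intro Max_in) auto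
  then obtain a0 where "?v a0 = Max (range ?v)" by (metis imageE)
  then have "\<forall>b. ?v b \<le> ?v a0" by simp
  then have "\<forall>b. ?v b \<le> ?v (SOME a. \<forall>b. ?v b \<le> ?v a)" by (rule someI)
  then show ?thesis using assms by (simp add: greedy_policy_def)
qed

text \<open>
  Let \<open>W\<close> be the running minimum of the noise score of the good action \<open>d\<close>. An action \<open>a\<close> is only
  played in \<open>s\<close> when its score is at least that of \<open>d\<close>, hence at least \<open>W\<close>, and one play costs at most
  \<open>C\<close>. When it is not played, its score stays put while \<open>W\<close> can only decrease. So no action ever
  falls more than \<open>C\<close> below \<open>W\<close>, however bad its mean gain is.
\<close>

lemma greedy_score_ge:
  fixes g :: "'s \<Rightarrow> 'a::finite \<Rightarrow> 's \<Rightarrow> real"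
  assumes "(xs, x) \<in> set_pmf (history_law \<mu> (greedy_policy g) p n)"
    and C: "\<And>s a x'. \<bar>g s a x'\<bar> \<le> C"
    and good: "\<And>x'. \<xi> s d x' \<le> g s d x'"
  shows "score \<xi> (xs, x) s d - reflected_score \<xi> (xs, x) s d - C \<le> score g (xs, x) s a"
  using assms(1)
proof (induction n arbitrary: xs x a)
  case 0
  have "0 \<le> C" using C abs_ge_zero order_trans by blast
  with 0 show ?case by (auto simp: score_Nil reflected_score_Nil)
next
  case (Suc n)
  then obtain ys y b where h: "(ys, y) \<in> set_pmf (history_law \<mu> (greedy_policy g) p n)"
    and b: "b \<in> set_pmf (greedy_policy g (ys, y))" and xs: "xs = ys @ [(y, b)]"
    by auto
  \<comment> \<open>Score minus reflected score is the running minimum of the score.\<close>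
  define W where "W = score \<xi> (ys, y) s d - reflected_score \<xi> (ys, y) s d"
  \<comment> \<open>The running minimum does not increase.\<close>
  have W': "score \<xi> (xs, x) s d - reflected_score \<xi> (xs, x) s d \<le> W"
    unfolding xs score_snoc reflected_score_snoc W_def by simp
  have IH: "W - C \<le> score g (ys, y) s a" for a
    unfolding W_def by (rule Suc.IH[OF h])
  have mart: "score \<xi> (zs, z) s d \<le> score g (zs, z) s d" for zs z
  proof (induction zs arbitrary: z rule: rev_induct)
    case (snoc v vs)
    then show ?case using good by (cases v) (auto simp: score_snoc intro: add_mono)
  qed (simp add: score_Nil)
  show ?case
  proof (cases "y = s \<and> b = a")
    case True
    have "W \<le> score \<xi> (ys, y) s d" using reflected_score_nonneg[of \<xi> ys y s d] by (simp add: W_def)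
    also have "\<dots> \<le> score g (ys, y) s d" by (rule mart)
    also have "\<dots> \<le> score g (ys, y) s a"
      using greedy_policy_maximizes[OF b, of d] True by simp
    finally have "W - C \<le> score g (xs, x) s a"
      using C[of s a x] True by (simp add: xs score_snoc abs_le_iff)
    with W' show ?thesis by simp
  next
    case False
    then have "score g (xs, x) s a = score g (ys, y) s a" by (auto simp: xs score_snoc)
    with W' IH[of a] show ?thesis by simp
  qed
qed

lemma payoff_centered:
  assumes "\<And>a. (\<Sum>x'\<in>UNIV. pmf (q a) x' * f a x') = 0"
  shows "payoff f \<phi> q = 0"
  by (simp add: payoff_nested assms)

lemma expectation_centered_score:
  fixes \<mu> :: "'s::finite pmf" and \<pi> :: "('s, 'a::finite) policy"
  assumes "(\<Sum>x'\<in>UNIV. pmf (p s a) x' * \<xi> s a x') = 0"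
  shows "0 \<le> history_expectation \<mu> \<pi> p n (\<lambda>h. score \<xi> h s a)"
proof -
  have "history_expectation \<mu> \<pi> p 0 (\<lambda>h. score \<xi> h s a) + real n * 0
      \<le> history_expectation \<mu> \<pi> p n (\<lambda>h. score \<xi> h s a)"
  proof (rule expectation_drift_ge)
    fix xs :: "('s \<times> 'a) list" and x
    let ?\<delta> = "\<lambda>b x'. if x = s \<and> b = a then \<xi> s a x' else 0"
    have "payoff (\<lambda>b x'. 1 * ?\<delta> b x' + score \<xi> (xs, x) s a) (\<pi> (xs, x)) (p x) = score \<xi> (xs, x) s a"
      unfolding payoff_affine
    proof (subst payoff_centered)
      show "(\<Sum>x'\<in>UNIV. pmf (p x b) x' * ?\<delta> b x') = 0" for b
        using assms by (cases "x = s \<and> b = a") auto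
    qed simp
    then show "score \<xi> (xs, x) s a + 0 \<le>
        payoff (\<lambda>b x'. score \<xi> (xs @ [(x, b)], x') s a) (\<pi> (xs, x)) (p x)"
      by (simp add: score_snoc add.commute)
  qed
  then show ?thesis by (simp add: score_Nil)
qed

text \<open>
  Reflection only decreases the square, so the second moment grows by at most \<open>B\<^sup>2\<close> per step, and the
  first moment is of order \<open>sqrt n\<close>.
\<close>

lemma expectation_reflected_score:
  fixes \<mu> :: "'s::finite pmf" and \<pi> :: "('s, 'a::finite) policy"
  assumes centered: "(\<Sum>x'\<in>UNIV. pmf (p s a) x' * \<xi> s a x') = 0"
    and bound: "\<And>x'. \<bar>\<xi> s a x'\<bar> \<le> B" and "n \<ge> 1"
  shows "history_expectation \<mu> \<pi> p n (\<lambda>h. reflected_score \<xi> h s a) \<le> (1 + B\<^sup>2) / 2 * sqrt (real n)"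
proof -
  let ?R = "\<lambda>h. reflected_score \<xi> h s a"
  have "history_expectation \<mu> \<pi> p n (\<lambda>h. (?R h)\<^sup>2) \<le>
      history_expectation \<mu> \<pi> p 0 (\<lambda>h. (?R h)\<^sup>2) + real n * B\<^sup>2"
  proof (rule expectation_drift_le)
    fix xs :: "('s \<times> 'a) list" and x
    define \<delta> where "\<delta> b x' = (if x = s \<and> b = a then \<xi> s a x' else 0)" for b x'
    have \<delta>_bound: "(\<delta> b x')\<^sup>2 \<le> B\<^sup>2" for b x'
      using bound[of x'] by (auto simp: \<delta>_def abs_le_square_iff[symmetric])
    have square_max: "(max 0 z)\<^sup>2 \<le> z\<^sup>2" for z :: real by (simp add: max_def)
    have "payoff (\<lambda>b x'. (?R (xs @ [(x, b)], x'))\<^sup>2) (\<pi> (xs, x)) (p x) \<le>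
        payoff (\<lambda>b x'. 2 * ?R (xs, x) * \<delta> b x' + ((?R (xs, x))\<^sup>2 + B\<^sup>2)) (\<pi> (xs, x)) (p x)"
    proof (rule payoff_mono)
      fix b x'
      have "(?R (xs @ [(x, b)], x'))\<^sup>2 \<le> (?R (xs, x) + \<delta> b x')\<^sup>2"
        unfolding reflected_score_snoc \<delta>_def by (rule square_max)
      also have "\<dots> \<le> 2 * ?R (xs, x) * \<delta> b x' + ((?R (xs, x))\<^sup>2 + B\<^sup>2)"
        using \<delta>_bound[of b x'] by (simp add: power2_sum)
      finally show "(?R (xs @ [(x, b)], x'))\<^sup>2 \<le> \<dots>" .
    qed
    also have "\<dots> = (?R (xs, x))\<^sup>2 + B\<^sup>2"
      unfolding payoff_affine
    proof (subst payoff_centered)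
      show "(\<Sum>x'\<in>UNIV. pmf (p x b) x' * \<delta> b x') = 0" for b
        using centered by (cases "x = s \<and> b = a") (auto simp: \<delta>_def)
    qed simp
    finally show "payoff (\<lambda>b x'. (?R (xs @ [(x, b)], x'))\<^sup>2) (\<pi> (xs, x)) (p x) \<le> (?R (xs, x))\<^sup>2 + B\<^sup>2" .
  qed
  then have second_moment: "history_expectation \<mu> \<pi> p n (\<lambda>h. (?R h)\<^sup>2) \<le> real n * B\<^sup>2"
    by (simp add: reflected_score_Nil)
  \<comment> \<open>The inequality between arithmetic and geometric means, balanced at the order of the second moment.\<close>
  define c where "c = sqrt (real n)"
  have c: "c > 0" "c\<^sup>2 = real n" using \<open>n \<ge> 1\<close> by (simp_all add: c_def)
  have "history_expectation \<mu> \<pi> p n ?R \<le> history_expectation \<mu> \<pi> p n (\<lambda>h. (1 / (2 * c)) * (?R h)\<^sup>2 + c / 2)"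
  proof (rule expectation_history_law_mono)
    fix h
    have "0 \<le> (?R h - c)\<^sup>2" by simp
    then show "?R h \<le> (1 / (2 * c)) * (?R h)\<^sup>2 + c / 2"
      using c by (simp add: power2_diff field_simps power2_eq_square)
  qed
  also have "\<dots> = (1 / (2 * c)) * history_expectation \<mu> \<pi> p n (\<lambda>h. (?R h)\<^sup>2) + c / 2"
    by (simp add: integrable_history_law)
  also have "\<dots> \<le> (1 / (2 * c)) * (real n * B\<^sup>2) + c / 2"
    using second_moment c by (intro add_right_mono mult_left_mono) auto
  also have "\<dots> = (1 + B\<^sup>2) / 2 * c"
    using c unfolding c(2)[symmetric] by (simp add: field_simps power2_eq_square)
  finally show ?thesis by (simp add: c_def)
qed

text \<open>
  Summed over all states and actions the gains telescope, and \<open>x0\<close> is the initial state of the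
  history.
\<close>

lemma total_reward_eq_score:
  fixes r :: "'s::finite \<Rightarrow> 'a::finite \<Rightarrow> real"
  shows "\<exists>x0. (\<Sum>s\<in>UNIV. \<Sum>a\<in>UNIV. score (\<lambda>s a x'. r s a - \<alpha> + u x' - u s) (xs, x) s a) =
    total_reward r (xs, x) - real (length xs) * \<alpha> + u x - u x0"
proof (induction xs arbitrary: x rule: rev_induct)
  case Nil
  show ?case by (intro exI[of _ x]) (simp add: score_Nil total_reward_Nil)
next
  case (snoc z zs)
  obtain y b where z: "z = (y, b)" by (cases z)
  let ?g = "\<lambda>s a x'. r s a - \<alpha> + u x' - u s"
  have "(\<Sum>s\<in>UNIV. \<Sum>a\<in>UNIV. if y = s \<and> b = a then ?g s a x else 0) =
      (\<Sum>s\<in>UNIV. if y = s then (\<Sum>a\<in>UNIV. if b = a then ?g s a x else 0) else 0)"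
    by (intro sum.cong) auto
  also have "\<dots> = ?g y b x" by simp
  finally have "(\<Sum>s\<in>UNIV. \<Sum>a\<in>UNIV. if y = s \<and> b = a then ?g s a x else 0) = ?g y b x" .
  then have "(\<Sum>s\<in>UNIV. \<Sum>a\<in>UNIV. score ?g (zs @ [z], x) s a) =
      (\<Sum>s\<in>UNIV. \<Sum>a\<in>UNIV. score ?g (zs, y) s a) + ?g y b x"
    by (simp only: z score_snoc sum.distrib)
  moreover obtain x0 where "(\<Sum>s\<in>UNIV. \<Sum>a\<in>UNIV. score ?g (zs, y) s a) =
      total_reward r (zs, y) - real (length zs) * \<alpha> + u y - u x0"
    using snoc.IH by blast
  ultimately show ?case
    by (intro exI[of _ x0]) (simp add: z total_reward_snoc[where x = y] algebra_simps)
qed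

lemma length_history_law: "h \<in> set_pmf (history_law \<mu> \<pi> p n) \<Longrightarrow> length (fst h) = n"
  by (induction n arbitrary: h) auto

text \<open>
  Split the gain of a good action \<open>d s\<close> as its nonnegative mean plus the centered noise \<open>\<xi>\<close>. Then all scores are bounded
  below by running minima of centered random walks with bounded increments, whose expectations are
  of order \<open>- sqrt n\<close>. The policy depends on \<open>r\<close>, \<open>u\<close> and \<open>\<alpha>\<close> but not on the kernel \<open>p\<close>, so that it can
  be played against an unknown kernel.
\<close>

theorem greedy_policy_expected_reward:
  fixes r :: "'s::finite \<Rightarrow> 'a::finite \<Rightarrow> real"
  assumes good: "\<And>s. \<exists>a. u s \<le> bellman_term r u \<alpha> s (return_pmf a) (p s)"
  shows "\<exists>B\<ge>0. \<forall>n\<ge>1. real n * \<alpha> - B * sqrt (real n) \<le>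
    history_expectation \<mu> (greedy_policy (\<lambda>s a x'. r s a - \<alpha> + u x' - u s)) p n (total_reward r)"
proof -
  define g where "g s a x' = r s a - \<alpha> + u x' - u s" for s a x'
  define \<xi> where "\<xi> s a x' = u x' - payoff (\<lambda>a x'. u x') (return_pmf a) (p s)" for s a x'
  obtain d where d: "\<And>s. u s \<le> bellman_term r u \<alpha> s (return_pmf (d s)) (p s)" using good by metis
  obtain U where U: "U \<ge> 0" "\<And>s. \<bar>u s\<bar> \<le> U" using finite_function_bounded[of u] by metis
  obtain V where V: "\<And>s a. \<bar>r s a\<bar> \<le> V" using finite_family_bounded[of r] by blast
  define C where "C = V + \<bar>\<alpha>\<bar> + 2 * U"
  have g_bound: "\<bar>g s a x'\<bar> \<le> C" for s a x'
    using U(2)[of s] U(2)[of x'] V[of s a] by (simp add: g_def C_def)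
  have \<xi>_bound: "\<bar>\<xi> s a x'\<bar> \<le> 2 * U" for s a x'
    using U(2)[of x'] abs_payoff_le[of "\<lambda>a x'. u x'" U "return_pmf a" "p s", OF U(2)]
    unfolding \<xi>_def by linarith
  have \<xi>_centered: "(\<Sum>x'\<in>UNIV. pmf (p s a) x' * \<xi> s a x') = 0" for s a
    by (simp add: \<xi>_def payoff_return_pmf right_diff_distrib sum_subtractf
        sum_distrib_right[symmetric] sum_pmf_eq_1)
  have \<xi>_le: "\<xi> s (d s) x' \<le> g s (d s) x'" for s x'
  proof -
    have "bellman_term r u \<alpha> s (return_pmf a) (p s) =
        r s a - \<alpha> + payoff (\<lambda>a x'. u x') (return_pmf a) (p s)" for a
      unfolding bellman_term_eq_payoff payoff_return_pmf
      by (simp add: distrib_left sum.distrib sum_distrib_right[symmetric] sum_pmf_eq_1)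
    then show ?thesis using d[of s] by (simp add: \<xi>_def g_def)
  qed
  let ?A = "real CARD('a)" and ?S = "real CARD('s)"
  let ?E = "history_expectation \<mu> (greedy_policy g) p"
  define c where "c = (1 + (2 * U)\<^sup>2) / 2"
  define B where "B = ?S * (?A * (c + C)) + 2 * U"
  have "0 \<le> C" using g_bound abs_ge_zero order_trans by blast
  have "real n * \<alpha> - B * sqrt (real n) \<le> ?E n (total_reward r)" if n: "n \<ge> 1" for n
  proof -
    let ?M = "\<lambda>s h. score \<xi> h s (d s)" and ?R = "\<lambda>s h. reflected_score \<xi> h s (d s)"
    have "?E n (\<lambda>h. real n * \<alpha> - 2 * U + (\<Sum>s\<in>UNIV. ?A * (?M s h - ?R s h - C))) \<le> ?E n (total_reward r)"
    proof (rule expectation_history_law_mono)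
      fix h assume h: "h \<in> set_pmf (history_law \<mu> (greedy_policy g) p n)"
      obtain xs x where hx: "h = (xs, x)" by (cases h)
      have len: "length xs = n" using length_history_law[OF h] by (simp add: hx)
      have "(\<Sum>s\<in>UNIV. ?A * (?M s h - ?R s h - C)) = (\<Sum>s\<in>UNIV. \<Sum>a\<in>(UNIV :: 'a set). ?M s h - ?R s h - C)"
        by simp
      also have "\<dots> \<le> (\<Sum>s\<in>UNIV. \<Sum>a\<in>UNIV. score g h s a)"
        unfolding hx using h[unfolded hx] g_bound \<xi>_le by (intro sum_mono greedy_score_ge)
      finally have "(\<Sum>s\<in>UNIV. ?A * (?M s h - ?R s h - C)) \<le> (\<Sum>s\<in>UNIV. \<Sum>a\<in>UNIV. score g h s a)" .
      moreover obtain x0 where "(\<Sum>s\<in>UNIV. \<Sum>a\<in>UNIV. score g h s a) =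
          total_reward r h - real n * \<alpha> + u x - u x0"
        using total_reward_eq_score[of r \<alpha> u xs x] by (auto simp: g_def[abs_def] hx len)
      ultimately show "real n * \<alpha> - 2 * U + (\<Sum>s\<in>UNIV. ?A * (?M s h - ?R s h - C)) \<le> total_reward r h"
        using U(2)[of x] U(2)[of x0] by (simp add: abs_le_iff)
    qed
    moreover have "?E n (\<lambda>h. real n * \<alpha> - 2 * U + (\<Sum>s\<in>UNIV. ?A * (?M s h - ?R s h - C))) =
        real n * \<alpha> - 2 * U + (\<Sum>s\<in>UNIV. ?A * (?E n (?M s) - ?E n (?R s) - C))"
      by (simp add: integrable_history_law)
    moreover have "(\<Sum>s\<in>(UNIV :: 's set). ?A * (0 - c * sqrt (real n) - C)) \<le>
        (\<Sum>s\<in>UNIV. ?A * (?E n (?M s) - ?E n (?R s) - C))"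
      unfolding c_def
      by (intro sum_mono mult_left_mono diff_mono order_refl expectation_centered_score
          expectation_reflected_score \<xi>_centered \<xi>_bound n) simp
    moreover have "real n * \<alpha> - B * sqrt (real n) \<le>
        real n * \<alpha> - 2 * U + (\<Sum>s\<in>(UNIV :: 's set). ?A * (0 - c * sqrt (real n) - C))"
    proof -
      have "1 \<le> sqrt (real n)" using n by simp
      then have "(?S * (?A * C) + 2 * U) * 1 \<le> (?S * (?A * C) + 2 * U) * sqrt (real n)"
        using \<open>0 \<le> C\<close> U(1) by (intro mult_left_mono) auto
      then show ?thesis by (simp add: B_def algebra_simps)
    qed
    ultimately show ?thesis by linarith
  qed
  moreover have "0 \<le> B" using \<open>0 \<le> C\<close> U(1) by (simp add: B_def c_def)
  ultimately show ?thesis unfolding g_def[abs_def] by blast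
qed

section \<open>Average rewards and values of the game\<close>

lemma lower_average_ge:
  fixes r :: "'s::finite \<Rightarrow> 'a::finite \<Rightarrow> real"
  assumes "\<And>n. n \<ge> 1 \<Longrightarrow> real n * \<alpha> - B * sqrt (real n) \<le> history_expectation \<mu> \<pi> p n (total_reward r)"
  shows "ereal \<alpha> \<le> lower_average r \<mu> \<pi> (\<lambda>h. p (snd h))"
proof -
  have "(\<lambda>n. \<alpha> - B / sqrt (real n)) \<longlonglongrightarrow> \<alpha> - 0"
    by (intro tendsto_intros tendsto_divide_0[OF tendsto_const] filterlim_at_top_imp_at_infinity
        filterlim_compose[OF sqrt_at_top filterlim_real_sequentially])
  then have "(\<lambda>n. ereal (\<alpha> - B / sqrt (real n))) \<longlonglongrightarrow> ereal \<alpha>" by simp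
  then have "ereal \<alpha> = liminf (\<lambda>n. ereal (\<alpha> - B / sqrt (real n)))"
    by (intro lim_imp_Liminf[symmetric]) auto
  also have "\<dots> \<le> lower_average r \<mu> \<pi> (\<lambda>h. p (snd h))"
    unfolding lower_average_def mean_reward_eq
  proof (rule Liminf_mono, rule eventually_sequentiallyI[of 1])
    fix n :: nat assume n: "1 \<le> n"
    have "\<alpha> - B / sqrt (real n) = (real n * \<alpha> - B * sqrt (real n)) / real n"
      using n by (simp add: field_simps real_div_sqrt)
    also have "\<dots> \<le> history_expectation \<mu> \<pi> p n (total_reward r) / real n"
      using assms[OF n] by (intro divide_right_mono) auto
    finally show "ereal (\<alpha> - B / sqrt (real n)) \<le> ereal (history_expectation \<mu> \<pi> p n (total_reward r) / real n)"
      by simp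
  qed
  finally show ?thesis .
qed

lemma upper_average_le:
  fixes r :: "'s::finite \<Rightarrow> 'a::finite \<Rightarrow> real"
  assumes "\<And>xs x. bellman_term r u \<alpha> x (\<pi> (xs, x)) (p x) \<le> u x"
  shows "upper_average r \<mu> \<pi> (\<lambda>h. p (snd h)) \<le> ereal \<alpha>"
proof -
  obtain B where B: "\<And>n. history_expectation \<mu> \<pi> p n (total_reward r) \<le> real n * \<alpha> + B"
    using expected_reward_le[OF assms] by metis
  have "(\<lambda>n. \<alpha> + B / real n) \<longlonglongrightarrow> \<alpha> + 0"
    by (intro tendsto_intros lim_const_over_n)
  then have lim: "(\<lambda>n. ereal (\<alpha> + B / real n)) \<longlonglongrightarrow> ereal \<alpha>" by simp
  have "upper_average r \<mu> \<pi> (\<lambda>h. p (snd h)) \<le> limsup (\<lambda>n. ereal (\<alpha> + B / real n))"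
    unfolding upper_average_def mean_reward_eq
  proof (rule Limsup_mono, rule eventually_sequentiallyI[of 1])
    fix n :: nat assume n: "1 \<le> n"
    have "history_expectation \<mu> \<pi> p n (total_reward r) / real n \<le> (real n * \<alpha> + B) / real n"
      using B by (intro divide_right_mono) auto
    also have "\<dots> = \<alpha> + B / real n" using n by (simp add: field_simps)
    finally show "ereal (history_expectation \<mu> \<pi> p n (total_reward r) / real n) \<le> ereal (\<alpha> + B / real n)"
      by simp
  qed
  also have "\<dots> = ereal \<alpha>" using lim by (intro lim_imp_Limsup) auto
  finally show ?thesis .
qed

lemma lower_value_le_upper_value: "lower_value r \<mu> PI KA \<le> upper_value r \<mu> PI KA"
  unfolding lower_value_def upper_value_def lower_average_def upper_average_def
  by (intro SUP_mono' INF_mono' Liminf_le_Limsup) auto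

lemma values_eqI:
  assumes \<pi>: "\<pi> \<in> PI" "\<And>\<kappa>. \<kappa> \<in> KA \<Longrightarrow> ereal \<alpha> \<le> lower_average r \<mu> \<pi> \<kappa>"
    and \<kappa>: "\<And>\<pi>. \<pi> \<in> PI \<Longrightarrow> \<exists>\<kappa>\<in>KA. upper_average r \<mu> \<pi> \<kappa> \<le> ereal \<alpha>"
  shows "lower_value r \<mu> PI KA = ereal \<alpha>" "upper_value r \<mu> PI KA = ereal \<alpha>"
proof -
  have "ereal \<alpha> \<le> lower_value r \<mu> PI KA"
    unfolding lower_value_def using \<pi> by (intro SUP_upper2[OF \<pi>(1)] INF_greatest)
  moreover have "upper_value r \<mu> PI KA \<le> ereal \<alpha>"
    unfolding upper_value_def
  proof (rule SUP_least)
    fix \<pi> assume "\<pi> \<in> PI"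
    from \<kappa>[OF this] obtain \<kappa> where "\<kappa> \<in> KA" "upper_average r \<mu> \<pi> \<kappa> \<le> ereal \<alpha>" by blast
    then show "(INF \<kappa>\<in>KA. upper_average r \<mu> \<pi> \<kappa>) \<le> ereal \<alpha>"
      using INF_lower2[of \<kappa> KA "upper_average r \<mu> \<pi>"] by blast
  qed
  ultimately show "lower_value r \<mu> PI KA = ereal \<alpha>" "upper_value r \<mu> PI KA = ereal \<alpha>"
    using lower_value_le_upper_value[of r \<mu> PI KA] by auto
qed

text \<open>
  A rule attaining the outer supremum in the sup-inf equation guarantees \<open>\<alpha>\<close> against every kernel.
  Conversely, a stationary policy reveals its rule, and the best reply to that rule in every state
  keeps the drift of reward at most \<open>\<alpha>\<close>.
\<close>

theorem stationary_values:
  fixes r :: "'s::finite \<Rightarrow> 'a::finite \<Rightarrow> real"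
  assumes sol: "sup_inf_solution r Q P u \<alpha>"
    and P: "\<And>s. P s \<noteq> {}" and Q: "Q \<noteq> {}"
    and cQ: "compact (pmf_vec ` Q)" and cP: "\<And>s. compact (kernel_vec ` P s)"
  shows "lower_value r \<mu> (stationary_policies Q) (stationary_adversaries P) = ereal \<alpha>"
    and "upper_value r \<mu> (stationary_policies Q) (stationary_adversaries P) = ereal \<alpha>"
proof -
  have u: "u s = (SUP \<phi>\<in>Q. INF q\<in>P s. bellman_term r u \<alpha> s \<phi> q)" for s
    using sol by (simp add: sup_inf_solution_def)
  have "\<exists>\<phi>\<in>Q. \<forall>q\<in>P s. u s \<le> bellman_term r u \<alpha> s \<phi> q" for s
    unfolding u[of s] bellman_term_eq_payoff by (rule SUP_INF_payoff_attained[OF cQ Q P])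
  then obtain \<Delta> where \<Delta>: "\<And>s. \<Delta> s \<in> Q" "\<And>s q. q \<in> P s \<Longrightarrow> u s \<le> bellman_term r u \<alpha> s (\<Delta> s) q"
    by metis
  have policy: "(\<lambda>h. \<Delta> (snd h)) \<in> stationary_policies Q"
    using \<Delta>(1) by (auto simp: stationary_policies_def stationary_rules_def)
  have lower: "ereal \<alpha> \<le> lower_average r \<mu> (\<lambda>h. \<Delta> (snd h)) \<kappa>" if "\<kappa> \<in> stationary_adversaries P" for \<kappa>
  proof -
    obtain p where \<kappa>: "\<kappa> = (\<lambda>h. p (snd h))" and p: "\<And>s. p s \<in> P s"
      using \<open>\<kappa> \<in> stationary_adversaries P\<close> by (auto simp: stationary_adversaries_def rectangular_def)
    obtain B where B: "B \<ge> 0" "\<And>n. real n * \<alpha> - B \<le> history_expectation \<mu> (\<lambda>h. \<Delta> (snd h)) p n (total_reward r)"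
      using expected_reward_ge[of u r \<alpha> "\<lambda>h. \<Delta> (snd h)" p \<mu>] \<Delta>(2)[OF p] by auto
    have "real n * \<alpha> - B * sqrt (real n) \<le> history_expectation \<mu> (\<lambda>h. \<Delta> (snd h)) p n (total_reward r)"
      if "n \<ge> 1" for n
    proof -
      have "B * 1 \<le> B * sqrt (real n)" using B(1) \<open>n \<ge> 1\<close> by (intro mult_left_mono) auto
      with B(2)[of n] show ?thesis by linarith
    qed
    then show ?thesis unfolding \<kappa> by (rule lower_average_ge)
  qed
  have upper: "\<exists>\<kappa>\<in>stationary_adversaries P. upper_average r \<mu> \<pi> \<kappa> \<le> ereal \<alpha>"
    if "\<pi> \<in> stationary_policies Q" for \<pi>
  proof -
    obtain \<Delta>' where \<pi>: "\<pi> = (\<lambda>h. \<Delta>' (snd h))" and \<Delta>': "\<And>s. \<Delta>' s \<in> Q"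
      using \<open>\<pi> \<in> stationary_policies Q\<close> by (auto simp: stationary_policies_def stationary_rules_def)
    have "\<exists>q\<in>P s. bellman_term r u \<alpha> s (\<Delta>' s) q \<le> u s" for s
      unfolding u[of s] bellman_term_eq_payoff by (rule payoff_best_reply_adversary[OF cP P \<Delta>'])
    then obtain p where p: "\<And>s. p s \<in> P s" "\<And>s. bellman_term r u \<alpha> s (\<Delta>' s) (p s) \<le> u s"
      by metis
    have "(\<lambda>h. p (snd h)) \<in> stationary_adversaries P"
      using p(1) by (auto simp: stationary_adversaries_def rectangular_def)
    moreover have "upper_average r \<mu> \<pi> (\<lambda>h. p (snd h)) \<le> ereal \<alpha>"
      by (rule upper_average_le[where u = u]) (simp add: \<pi> p(2))
    ultimately show ?thesis by blast
  qed
  show "lower_value r \<mu> (stationary_policies Q) (stationary_adversaries P) = ereal \<alpha>"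
    and "upper_value r \<mu> (stationary_policies Q) (stationary_adversaries P) = ereal \<alpha>"
    using values_eqI[OF policy lower upper] by blast+
qed

text \<open>
  The kernel attaining the outer infimum in the inf-sup equation keeps every policy at or below \<open>\<alpha>\<close>.
  Conversely, whatever the kernel is, in each state some action has nonnegative mean gain relative to
  \<open>u\<close> and \<open>\<alpha>\<close>, and the greedy policy does asymptotically as well as if it knew these actions.
\<close>

theorem history_values:
  fixes r :: "'s::finite \<Rightarrow> 'a::finite \<Rightarrow> real"
  assumes sol: "inf_sup_solution r Q P u \<alpha>"
    and P: "\<And>s. P s \<noteq> {}" and dirac: "\<And>a. return_pmf a \<in> Q"
    and cQ: "compact (pmf_vec ` Q)" and cP: "\<And>s. compact (kernel_vec ` P s)"
  shows "lower_value r \<mu> (history_policies Q) (stationary_adversaries P) = ereal \<alpha>"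
    and "upper_value r \<mu> (history_policies Q) (stationary_adversaries P) = ereal \<alpha>"
proof -
  have Q: "Q \<noteq> {}" using dirac by blast
  have u: "u s = (INF q\<in>P s. SUP \<phi>\<in>Q. bellman_term r u \<alpha> s \<phi> q)" for s
    using sol by (simp add: inf_sup_solution_def)
  let ?\<pi> = "greedy_policy (\<lambda>s a x'. r s a - \<alpha> + u x' - u s)"
  have policy: "?\<pi> \<in> history_policies Q"
    using dirac by (simp add: history_policies_def greedy_policy_def)
  have lower: "ereal \<alpha> \<le> lower_average r \<mu> ?\<pi> \<kappa>" if "\<kappa> \<in> stationary_adversaries P" for \<kappa>
  proof -
    obtain p where \<kappa>: "\<kappa> = (\<lambda>h. p (snd h))" and p: "\<And>s. p s \<in> P s"
      using \<open>\<kappa> \<in> stationary_adversaries P\<close> by (auto simp: stationary_adversaries_def rectangular_def)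
    have "\<exists>a. u s \<le> bellman_term r u \<alpha> s (return_pmf a) (p s)" for s
    proof -
      let ?f = "\<lambda>a s'. r s a - \<alpha> + u s'"
      obtain \<phi> where "u s \<le> payoff ?f \<phi> (p s)"
        using payoff_best_reply_controller[where f = ?f, OF cQ Q p[of s]] u[of s]
        unfolding bellman_term_eq_payoff by auto
      with payoff_le_some_action[of ?f \<phi> "p s"] show ?thesis
        unfolding bellman_term_eq_payoff by (meson order_trans)
    qed
    then obtain B where "\<And>n. n \<ge> 1 \<Longrightarrow> real n * \<alpha> - B * sqrt (real n) \<le> history_expectation \<mu> ?\<pi> p n (total_reward r)"
      using greedy_policy_expected_reward[of u r \<alpha> p \<mu>] by blast
    then show ?thesis unfolding \<kappa> by (rule lower_average_ge)
  qed
  have "\<exists>q\<in>P s. \<forall>\<phi>\<in>Q. bellman_term r u \<alpha> s \<phi> q \<le> u s" for s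
    unfolding u[of s] bellman_term_eq_payoff by (rule INF_SUP_payoff_attained[OF cP Q P])
  then obtain p where p: "\<And>s. p s \<in> P s" "\<And>s \<phi>. \<phi> \<in> Q \<Longrightarrow> bellman_term r u \<alpha> s \<phi> (p s) \<le> u s"
    by metis
  have upper: "\<exists>\<kappa>\<in>stationary_adversaries P. upper_average r \<mu> \<pi> \<kappa> \<le> ereal \<alpha>"
    if "\<pi> \<in> history_policies Q" for \<pi>
  proof
    show "(\<lambda>h. p (snd h)) \<in> stationary_adversaries P"
      using p(1) by (auto simp: stationary_adversaries_def rectangular_def)
    show "upper_average r \<mu> \<pi> (\<lambda>h. p (snd h)) \<le> ereal \<alpha>"
      using that by (intro upper_average_le[where u = u] p(2)) (simp add: history_policies_def)
  qed
  show "lower_value r \<mu> (history_policies Q) (stationary_adversaries P) = ereal \<alpha>"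
    and "upper_value r \<mu> (history_policies Q) (stationary_adversaries P) = ereal \<alpha>"
    using values_eqI[OF policy lower upper] by blast+
qed

theorem corollary8p1:
  fixes r :: "'s::finite \<Rightarrow> 'a::finite \<Rightarrow> real"
    and Q :: "'a pmf set"
    and P :: "'s \<Rightarrow> ('a \<Rightarrow> 's pmf) set"
  assumes "\<And>s a. 0 \<le> r s a \<and> r s a \<le> 1"
    and "\<And>s. P s \<noteq> {}"
    and "weakly_communicating_controller Q P"
    and "weakly_communicating_adversary Q P"
    and "{return_pmf a | a. a \<in> UNIV} \<subseteq> Q"
    and "compact (pmf_vec ` Q)"
    and "\<And>s. compact (kernel_vec ` P s)"
  shows "(\<exists>u \<alpha>. sup_inf_solution r Q P u \<alpha>) \<and>
         (\<exists>u \<alpha>. inf_sup_solution r Q P u \<alpha>) \<and>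
         (\<forall>u_star \<alpha>_star u' \<alpha>'.
            sup_inf_solution r Q P u_star \<alpha>_star \<longrightarrow>
            inf_sup_solution r Q P u' \<alpha>' \<longrightarrow>
            ((\<forall>\<mu>. upper_value r \<mu> (stationary_policies Q) (stationary_adversaries P) =
                   upper_value r \<mu> (history_policies Q) (stationary_adversaries P) \<and>
                   lower_value r \<mu> (stationary_policies Q) (stationary_adversaries P) =
                   lower_value r \<mu> (history_policies Q) (stationary_adversaries P))
             \<longleftrightarrow> \<alpha>' = \<alpha>_star))"
proof -
  have Q: "Q \<noteq> {}" and dirac: "\<And>a. return_pmf a \<in> Q" using assms(5) by auto
  note cQ = assms(6) and cP = assms(7) and P = assms(2)
  have "(\<forall>\<mu>. upper_value r \<mu> (stationary_policies Q) (stationary_adversaries P) =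
          upper_value r \<mu> (history_policies Q) (stationary_adversaries P) \<and>
          lower_value r \<mu> (stationary_policies Q) (stationary_adversaries P) =
          lower_value r \<mu> (history_policies Q) (stationary_adversaries P)) \<longleftrightarrow> \<alpha>' = \<alpha>_star"
    if "sup_inf_solution r Q P u_star \<alpha>_star" "inf_sup_solution r Q P u' \<alpha>'" for u_star \<alpha>_star u' \<alpha>'
    unfolding stationary_values[OF that(1) P Q cQ cP] history_values[OF that(2) P dirac cQ cP]
    by auto
  then show ?thesis
    using sup_inf_solution_exists[where r = r, OF assms(1) P Q assms(3) cQ cP]
      inf_sup_solution_exists[where r = r, OF assms(1) P Q assms(4) cQ cP] by blast
qed

end
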